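(* The NFA Acceptance hypothesis implies the OMv Hypothesis.
   Context: An NFA is a tuple $M=(Q,\Sigma,\delta,q_0,F)$ with $\delta\subseteq Q\times\Sigma\times Q$ (no $\epsilon$-transitions); $M$ accepts $x\in\Sigma^*$ if there are states $q_1,\dots,q_{|x|}$ with $(q_i,x_{i+1},q_{i+1})\in\delta$ for all $0\le i<|x|$ and $q_{|x|}\in F$. The NFA Acceptance hypothesis states: for all $\alpha\in[1,2]$ and all $\beta,\varepsilon>0$, there is no (randomized) algorithm deciding whether an NFA with $n$ states, $m=\Theta(n^\alpha)$ transitions and alphabet size $n^{o(1)}$ accepts a string of length $\ell=\Theta(n^\beta)$ in time $O((m\ell)^{1-\varepsilon})$. Online Boolean Matrix-Vector Multiplication (OMv): an algorithm is first given an $n\times n$ Boolean matrix $M$; then for $n$ rounds, in round $i$ it receives a Boolean vector $v_i\in\{0,1\}^n$ and must output the Boolean product $Mv_i$ before receiving the next vector. The running time is the total time over initialization and all rounds. The OMv Hypothesis states: for every constant $\varepsilon>0$, OMv has no $O(n^{3-\varepsilon})$-time algorithm with error probability at most $1/3$. *)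

theory Defs
  imports
    "HOL-Probability.Probability_Mass_Function"
    "HOL-Library.Landau_Symbols"
begin

section \<open>Nondeterministic finite automata\<close>

record ('q, 'a) nfa =
  states :: "'q set"
  alphabet :: "'a set"
  transitions :: "('q \<times> 'a \<times> 'q) set"
  start :: 'q
  final :: "'q set"

definition is_nfa :: "('q, 'a) nfa \<Rightarrow> bool" where
  "is_nfa M \<longleftrightarrow>
     finite (states M) \<and> finite (alphabet M) \<and>
     transitions M \<subseteq> states M \<times> alphabet M \<times> states M \<and>
     start M \<in> states M \<and> final M \<subseteq> states M"

definition accepts :: "('q, 'a) nfa \<Rightarrow> 'a list \<Rightarrow> bool" where
  "accepts M x \<longleftrightarrow>
     (\<exists>q :: nat \<Rightarrow> 'q. q 0 = start M \<and>
        (\<forall>i \<le> length x. q i \<in> states M) \<and>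
        (\<forall>i < length x. (q i, x ! i, q (Suc i)) \<in> transitions M) \<and>
        q (length x) \<in> final M)"


section \<open>Randomized word RAM\<close>

text \<open>
  Algorithms are programs for a unit-cost random access machine with indirect addressing. A
  program is a fixed finite object, independent of the input size, and uses finitely many
  registers. Control flow is structured; compared with jumps this changes running times by a
  constant factor only.
\<close>

datatype binop = Add | Sub | Mul | Div | Mod | BitAnd | BitOr | BitXor | Shl | Shr | Less | Equal

fun binop_sem :: "binop \<Rightarrow> nat \<Rightarrow> nat \<Rightarrow> nat" where
  "binop_sem Add a b = a + b"
| "binop_sem Sub a b = a - b"
| "binop_sem Mul a b = a * b"
| "binop_sem Div a b = a div b"
| "binop_sem Mod a b = a mod b"
| "binop_sem BitAnd a b = semiring_bit_operations_class.and a b"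
| "binop_sem BitOr a b = semiring_bit_operations_class.or a b"
| "binop_sem BitXor a b = semiring_bit_operations_class.xor a b"
| "binop_sem Shl a b = push_bit b a"
| "binop_sem Shr a b = drop_bit b a"
| "binop_sem Less a b = of_bool (a < b)"
| "binop_sem Equal a b = of_bool (a = b)"

datatype com =
    Skip
  | SetConst nat nat            \<comment> \<open>\<open>SetConst r k\<close>: \<open>r := k\<close>\<close>
  | BinOp binop nat nat nat     \<comment> \<open>\<open>BinOp f r a b\<close>: \<open>r := f a b\<close>\<close>
  | Load nat nat                \<comment> \<open>\<open>Load r a\<close>: \<open>r := mem[a]\<close>\<close>
  | Store nat nat               \<comment> \<open>\<open>Store a r\<close>: \<open>mem[a] := r\<close>\<close>
  | Flip nat                    \<comment> \<open>\<open>Flip r\<close>: \<open>r :=\<close> a fresh random bit\<close>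
  | Seq com com
  | Cond nat com com            \<comment> \<open>first branch if the register is nonzero\<close>
  | While nat com               \<comment> \<open>loop as long as the register is nonzero\<close>

text \<open>The field \<open>coins\<close> is the part of the random tape that has not been read yet.\<close>

record state =
  reg :: "nat \<Rightarrow> nat"
  mem :: "nat \<Rightarrow> nat"
  coins :: "bool list"

text \<open>
  \<open>exec w c s t s'\<close>: with word size \<open>w\<close>, program \<open>c\<close> started in \<open>s\<close> halts in \<open>s'\<close> after \<open>t\<close>
  steps. A run has to keep all numbers it handles below \<open>2 ^ w\<close>: on overflow, and on reading
  past the end of the random tape, it is stuck and there is no final state.
\<close>

inductive exec :: "nat \<Rightarrow> com \<Rightarrow> state \<Rightarrow> nat \<Rightarrow> state \<Rightarrow> bool" for w :: nat where
  Skip: "exec w Skip s 1 s"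
| SetConst: "k < 2 ^ w \<Longrightarrow>
    exec w (SetConst r k) s 1 (s\<lparr>reg := (reg s)(r := k)\<rparr>)"
| BinOp: "x = binop_sem f (reg s a) (reg s b) \<Longrightarrow> x < 2 ^ w \<Longrightarrow>
    exec w (BinOp f r a b) s 1 (s\<lparr>reg := (reg s)(r := x)\<rparr>)"
| Load: "mem s (reg s a) < 2 ^ w \<Longrightarrow>
    exec w (Load r a) s 1 (s\<lparr>reg := (reg s)(r := mem s (reg s a))\<rparr>)"
| Store:
    "exec w (Store a r) s 1 (s\<lparr>mem := (mem s)(reg s a := reg s r)\<rparr>)"
| Flip: "coins s = b # bs \<Longrightarrow> of_bool b < (2 :: nat) ^ w \<Longrightarrow>
    exec w (Flip r) s 1 (s\<lparr>reg := (reg s)(r := of_bool b), coins := bs\<rparr>)"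
| Seq: "exec w c1 s t1 s1 \<Longrightarrow> exec w c2 s1 t2 s2 \<Longrightarrow>
    exec w (Seq c1 c2) s (t1 + t2) s2"
| CondTrue: "reg s r \<noteq> 0 \<Longrightarrow> exec w c1 s t s1 \<Longrightarrow>
    exec w (Cond r c1 c2) s (1 + t) s1"
| CondFalse: "reg s r = 0 \<Longrightarrow> exec w c2 s t s1 \<Longrightarrow>
    exec w (Cond r c1 c2) s (1 + t) s1"
| WhileFalse: "reg s r = 0 \<Longrightarrow>
    exec w (While r c) s 1 s"
| WhileTrue: "reg s r \<noteq> 0 \<Longrightarrow> exec w c s t1 s1 \<Longrightarrow> exec w (While r c) s1 t2 s2 \<Longrightarrow>
    exec w (While r c) s (1 + t1 + t2) s2"

inductive_cases exec_SkipE: "exec w Skip s t s'"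
  and exec_SetConstE: "exec w (SetConst r k) s t s'"
  and exec_BinOpE: "exec w (BinOp f r a b) s t s'"
  and exec_LoadE: "exec w (Load r a) s t s'"
  and exec_StoreE: "exec w (Store a r) s t s'"
  and exec_FlipE: "exec w (Flip r) s t s'"
  and exec_SeqE: "exec w (Seq c1 c2) s t s'"
  and exec_CondE: "exec w (Cond r c1 c2) s t s'"
  and exec_WhileE: "exec w (While r c) s t s'"

lemma exec_deterministic:
  assumes "exec w c s t s'" and "exec w c s u s''"
  shows "u = t \<and> s'' = s'"
  using assms
proof (induction arbitrary: u s'' rule: exec.induct)
  case Skip
  then show ?case by (rule exec_SkipE) simp
next
  case SetConst
  from SetConst.prems show ?case by (rule exec_SetConstE) simp
next
  case BinOp
  from BinOp.prems show ?case by (rule exec_BinOpE) (use BinOp.hyps in simp)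
next
  case Load
  from Load.prems show ?case by (rule exec_LoadE) simp
next
  case Store
  then show ?case by (rule exec_StoreE) simp
next
  case Flip
  from Flip.prems show ?case by (rule exec_FlipE) (use Flip.hyps in simp)
next
  case Seq
  from Seq.prems show ?case by (rule exec_SeqE) (metis Seq.IH)
next
  case CondTrue
  from CondTrue.prems show ?case by (rule exec_CondE) (use CondTrue.hyps in \<open>auto dest: CondTrue.IH\<close>)
next
  case CondFalse
  from CondFalse.prems show ?case by (rule exec_CondE) (use CondFalse.hyps in \<open>auto dest: CondFalse.IH\<close>)
next
  case WhileFalse
  from WhileFalse.prems show ?case by (rule exec_WhileE) (use WhileFalse.hyps in simp_all)
next
  case WhileTrue
  from WhileTrue.prems show ?case by (rule exec_WhileE) (use WhileTrue.hyps in \<open>auto dest!: WhileTrue.IH\<close>)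
qed

definition write_list :: "nat \<Rightarrow> nat list \<Rightarrow> (nat \<Rightarrow> nat) \<Rightarrow> nat \<Rightarrow> nat" where
  "write_list k xs f = (\<lambda>a. if k \<le> a \<and> a < k + length xs then xs ! (a - k) else f a)"

definition init_state :: "nat list \<Rightarrow> bool list \<Rightarrow> state" where
  "init_state xs bs = \<lparr>reg = (\<lambda>_. 0), mem = write_list 0 xs (\<lambda>_. 0), coins = bs\<rparr>"

definition coin_prob :: "nat \<Rightarrow> (bool list \<Rightarrow> bool) \<Rightarrow> real" where
  "coin_prob N P = measure_pmf.prob (pmf_of_set {bs. length bs = N}) {bs. P bs}"


section \<open>The NFA Acceptance hypothesis\<close>

text \<open>
  The enumerations of the final states and of the transitions are arbitrary; an algorithm has to
  work for all of them.
\<close>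

definition nfa_encoding :: "(nat, nat) nfa \<Rightarrow> nat list \<Rightarrow> nat list \<Rightarrow> bool" where
  "nfa_encoding M x inp \<longleftrightarrow>
     (\<exists>fs ts. distinct fs \<and> set fs = final M \<and> distinct ts \<and> set ts = transitions M \<and>
        inp = [card (states M), card (alphabet M), start M, length fs, length ts, length x]
              @ fs @ concat (map (\<lambda>(p, a, q). [p, a, q]) ts) @ x)"

text \<open>
  The parameters \<open>m\<close>, \<open>l\<close>, \<open>\<sigma>\<close> give the number of transitions, the string length and the alphabet
  size as functions of the number \<open>n\<close> of states. The time bound \<open>T\<close> holds for all outcomes of the
  coin flips; as each flip takes a step, a random tape of length \<open>T n\<close> suffices. The answer is
  returned in register 0.
\<close>

definition decides_nfa_acceptance ::
  "com \<Rightarrow> (nat \<Rightarrow> nat) \<Rightarrow> (nat \<Rightarrow> nat) \<Rightarrow> (nat \<Rightarrow> nat) \<Rightarrow> (nat \<Rightarrow> nat) \<Rightarrow> (nat \<Rightarrow> nat) \<Rightarrow> bool" where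
  "decides_nfa_acceptance A m l \<sigma> T w \<longleftrightarrow>
     (\<forall>n > 0. \<forall>M x inp.
        is_nfa M \<and> states M = {..<n} \<and> alphabet M = {..<\<sigma> n} \<and> card (transitions M) = m n \<and>
        set x \<subseteq> alphabet M \<and> length x = l n \<and> nfa_encoding M x inp \<longrightarrow>
          (\<forall>bs. length bs = T n \<longrightarrow> (\<exists>t \<le> T n. \<exists>s. exec (w n) A (init_state inp bs) t s)) \<and>
          coin_prob (T n) (\<lambda>bs. \<exists>t s. exec (w n) A (init_state inp bs) t s \<and>
             reg s 0 \<noteq> of_bool (accepts M x)) \<le> 1 / 3)"

text \<open>\<open>\<sigma>(n) = n\<^bsup>o(1)\<^esup>\<close>\<close>

definition subpolynomial :: "(nat \<Rightarrow> nat) \<Rightarrow> bool" where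
  "subpolynomial \<sigma> \<longleftrightarrow>
     (\<exists>e :: nat \<Rightarrow> real. e \<in> o(\<lambda>_. 1) \<and>
        (\<forall>\<^sub>F n in at_top. real (\<sigma> n) = real n powr e n))"

text \<open>
  An algorithm is a single program for all choices of \<open>m\<close>, \<open>l\<close>, \<open>\<sigma>\<close> with the prescribed growth,
  where the constants hidden in its running time and word size may depend on this choice.
\<close>

definition NFA_Acceptance_hypothesis :: bool where
  "NFA_Acceptance_hypothesis \<longleftrightarrow>
     (\<forall>\<alpha> \<in> {1..2 :: real}. \<forall>\<beta> > (0 :: real). \<forall>\<epsilon> > (0 :: real).
        \<not> (\<exists>A. \<forall>m l \<sigma>.
              (\<lambda>n. real (m n)) \<in> \<Theta>(\<lambda>n. real n powr \<alpha>) \<and>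
              (\<lambda>n. real (l n)) \<in> \<Theta>(\<lambda>n. real n powr \<beta>) \<and>
              subpolynomial \<sigma> \<longrightarrow>
              (\<exists>T w. (\<lambda>n. real (T n)) \<in> O(\<lambda>n. (real (m n) * real (l n)) powr (1 - \<epsilon>)) \<and>
                 (\<lambda>n. real (w n)) \<in> O(\<lambda>n. ln (real n)) \<and>
                 decides_nfa_acceptance A m l \<sigma> T w)))"


section \<open>The OMv hypothesis\<close>

text \<open>
  Boolean \<open>n \<times> n\<close> matrices and vectors of length \<open>n\<close> are functions of which only the entries with
  indices below \<open>n\<close> matter.
\<close>

definition bool_mat_vec :: "nat \<Rightarrow> (nat \<Rightarrow> nat \<Rightarrow> bool) \<Rightarrow> (nat \<Rightarrow> bool) \<Rightarrow> nat \<Rightarrow> bool" where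
  "bool_mat_vec n M v i \<longleftrightarrow> (\<exists>j < n. M i j \<and> v j)"

definition vec_words :: "nat \<Rightarrow> (nat \<Rightarrow> bool) \<Rightarrow> nat list" where
  "vec_words n v = map (\<lambda>i. of_bool (v i)) [0..<n]"

definition omv_input :: "nat \<Rightarrow> (nat \<Rightarrow> nat \<Rightarrow> bool) \<Rightarrow> nat list" where
  "omv_input n M = n # concat (map (\<lambda>i. vec_words n (M i)) [0..<n])"

text \<open>
  An online algorithm is a pair of programs: one is run once on the matrix, the other is run in each
  round and continues on the state left by the previous run. At the start of a round the vector is
  placed in the \<open>n\<close> memory cells following the matrix; at the end of the round the product is read
  from the next \<open>n\<close> cells. So the product is fixed before the next vector becomes available.
\<close>

inductive omv_rounds ::
  "nat \<Rightarrow> com \<Rightarrow> nat \<Rightarrow> state \<Rightarrow> (nat \<Rightarrow> bool) list \<Rightarrow> nat \<Rightarrow> nat list list \<Rightarrow> bool"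
  for w :: nat and Q :: com and n :: nat where
  "omv_rounds w Q n s [] 0 []"
| "exec w Q (s\<lparr>mem := write_list (1 + n * n) (vec_words n v) (mem s)\<rparr>) t1 s1 \<Longrightarrow>
   omv_rounds w Q n s1 vs t2 outs \<Longrightarrow>
   omv_rounds w Q n s (v # vs) (t1 + t2)
     (map (mem s1) [1 + n * n + n ..< 1 + n * n + 2 * n] # outs)"

definition omv_run ::
  "nat \<Rightarrow> com \<Rightarrow> com \<Rightarrow> nat \<Rightarrow> (nat \<Rightarrow> nat \<Rightarrow> bool) \<Rightarrow> (nat \<Rightarrow> bool) list \<Rightarrow> bool list \<Rightarrow>
     nat \<Rightarrow> nat list list \<Rightarrow> bool" where
  "omv_run w P Q n M vs bs t outs \<longleftrightarrow>
     (\<exists>t0 s0 t1. exec w P (init_state (omv_input n M) bs) t0 s0 \<and>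
        omv_rounds w Q n s0 vs t1 outs \<and> t = t0 + t1)"

definition solves_omv :: "com \<Rightarrow> com \<Rightarrow> (nat \<Rightarrow> nat) \<Rightarrow> (nat \<Rightarrow> nat) \<Rightarrow> bool" where
  "solves_omv P Q T w \<longleftrightarrow>
     (\<forall>n > 0. \<forall>M vs. length vs = n \<longrightarrow>
        (\<forall>bs. length bs = T n \<longrightarrow> (\<exists>t \<le> T n. \<exists>outs. omv_run (w n) P Q n M vs bs t outs)) \<and>
        coin_prob (T n) (\<lambda>bs. \<exists>t outs. omv_run (w n) P Q n M vs bs t outs \<and>
           outs \<noteq> map (\<lambda>v. vec_words n (bool_mat_vec n M v)) vs) \<le> 1 / 3)"

definition OMv_hypothesis :: bool where
  "OMv_hypothesis \<longleftrightarrow>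
     (\<forall>\<epsilon> > (0 :: real).
        \<not> (\<exists>P Q T w. (\<lambda>n. real (T n)) \<in> O(\<lambda>n. real n powr (3 - \<epsilon>)) \<and>
              (\<lambda>n. real (w n)) \<in> O(\<lambda>n. ln (real n)) \<and>
              solves_omv P Q T w))"

end

theory Submission
  imports Defs
begin

text \<open>
  Reading a letter \<open>a\<close> replaces the set \<open>S\<close> of reachable states by the Boolean product of the
  transition matrix of \<open>a\<close> with the indicator vector of \<open>S\<close>. The transposed transition matrices of
  all letters, written side by side and padded to a square matrix of size \<open>N = n (\<sigma> + 1) + l\<close>, make up
  one OMv instance that allows \<open>N \<ge> l\<close> rounds. The queries are adaptive, but as long as all
  answers are right they agree with a sequence that only depends on the automaton and the string.
  Hence the answer is wrong only if the OMv algorithm fails on this fixed sequence, and there is no need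
  for amplification. For \<open>m = \<Theta>(n\<^sup>2)\<close> and \<open>l = \<Theta>(n)\<close> we have \<open>N = n\<^bsup>1 + o(1)\<^esup>\<close> and
  \<open>m l = \<Theta>(n\<^sup>3)\<close>, so time \<open>N\<^bsup>3 - \<epsilon>\<^esup>\<close> beats \<open>m l\<close> polynomially.
\<close>

section \<open>Execution with time bounds\<close>

text \<open>The guarantee for OMv concerns exactly \<open>N\<close> vectors fixed in advance,
  whereas the driver derives its vectors from earlier, possibly wrong answers and stops after
  \<open>l\<close> rounds. Two facts reconcile this. For a fixed random tape \<open>exec\<close> is
  deterministic, so a time bound for all sequences of \<open>N\<close> vectors also bounds every
  adaptive run. And the rounds that are not played are filled with zero vectors in the specification
  only. Hence the driver halts in time unconditionally; only its final answer depends on correct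
  products.

  The second obstacle is that a run which overflows is stuck. The OMv programs address memory from 0
  on, so their memory is moved above all data of the driver, and the sum of base and offset may take
  one more bit than each of the two.

  The summand \<open>n\<close> in the size \<open>N\<close> gives \<open>n \<le> N\<close> even for
  an empty alphabet, so the rows have room for all target states. The program must not depend on
  \<open>m\<close>, \<open>l\<close>, \<open>\<sigma>\<close>; it reads their values from the header
  of its input.\<close>

lemma exec_mono:
  assumes "exec w c s t s'" and "w \<le> W"
  shows "exec W c s t s'"
proof -
  have *: "x < 2 ^ W" if "x < 2 ^ w" for x :: nat
    using that assms(2) by (meson less_le_trans one_le_numeral power_increasing)
  show ?thesis
    using assms(1) by induction (blast intro: exec.intros *)+
qed

text \<open>\<open>exec\<close> checks only the values that enter a register. As an invariant, this
  predicate bounds every register, in particular every address that a relocated program adds to its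
  base.\<close>

definition bounded_state :: "nat \<Rightarrow> state \<Rightarrow> bool" where
  "bounded_state W s \<longleftrightarrow> (\<forall>r. reg s r < 2 ^ W) \<and> (\<forall>a. mem s a < 2 ^ W)"

lemma exec_bounded_state:
  assumes "exec W c s t s'" and "bounded_state W s"
  shows "bounded_state W s'"
  using assms by induction (auto simp: bounded_state_def)

text \<open>Total correctness with a time bound. One halting run is enough, because by
  \<open>exec_deterministic\<close> it is the only one.\<close>

definition runs :: "nat \<Rightarrow> com \<Rightarrow> state \<Rightarrow> nat \<Rightarrow> (state \<Rightarrow> bool) \<Rightarrow> bool" where
  "runs w c s T Q \<longleftrightarrow> (\<exists>t \<le> T. \<exists>s'. exec w c s t s' \<and> Q s')"

lemma runsI: "exec w c s t s' \<Longrightarrow> t \<le> T \<Longrightarrow> Q s' \<Longrightarrow> runs w c s T Q"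
  by (auto simp: runs_def)

lemma runs_mono:
  assumes "runs w c s T Q" and "T \<le> T'" and "\<And>s'. Q s' \<Longrightarrow> Q' s'"
  shows "runs w c s T' Q'"
  using assms unfolding runs_def by (meson le_trans)

lemma runs_Seq:
  assumes "runs w c1 s T1 R" and "\<And>s1. R s1 \<Longrightarrow> runs w c2 s1 T2 Q" and "T1 + T2 \<le> T"
  shows "runs w (Seq c1 c2) s T Q"
proof -
  obtain t1 s1 where 1: "t1 \<le> T1" "exec w c1 s t1 s1" "R s1"
    using assms(1) by (auto simp: runs_def)
  obtain t2 s2 where 2: "t2 \<le> T2" "exec w c2 s1 t2 s2" "Q s2"
    using assms(2)[OF 1(3)] by (auto simp: runs_def)
  show ?thesis
    using exec.Seq[OF 1(2) 2(2)] by (rule runsI) (use 1 2 assms(3) in auto)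
qed

text \<open>The trailing \<open>Skip\<close> costs a step; this accounts for one unit in the time
  bound of every block.\<close>

fun block :: "com list \<Rightarrow> com" where
  "block [] = Skip"
| "block (c # cs) = Seq c (block cs)"

lemmas runs_Cons = runs_Seq[where ?c2.0 = "block cs" for cs, folded block.simps]

lemma runs_Nil [simp]: "runs w (block []) s T Q \<longleftrightarrow> 1 \<le> T \<and> Q s"
  by (auto simp: runs_def intro: exec.intros[simplified] elim: exec_SkipE)

text \<open>For commands of one step the triple is an equivalence. Its instances below are
  simplification rules, so that \<open>simp\<close> executes straight-line blocks symbolically;
  \<open>block\<close> stays folded for them to match. Loops and relocated programs go through
  \<open>runs_Cons\<close> instead.\<close>

lemma runs_Seq_unit:
  assumes "\<And>t s'. exec w c s t s' \<longleftrightarrow> P \<and> t = 1 \<and> s' = f"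
  shows "runs w (Seq c d) s T Q \<longleftrightarrow> 1 \<le> T \<and> P \<and> runs w d f (T - 1) Q"
proof
  assume "runs w (Seq c d) s T Q"
  then obtain t s' where "t \<le> T" "exec w (Seq c d) s t s'" "Q s'"
    by (auto simp: runs_def)
  then obtain t1 s1 t2 where "exec w c s t1 s1" "exec w d s1 t2 s'" "t1 + t2 \<le> T" "Q s'"
    by (auto elim!: exec_SeqE)
  then show "1 \<le> T \<and> P \<and> runs w d f (T - 1) Q"
    using assms by (auto simp: runs_def intro!: exI[of _ t2])
next
  assume *: "1 \<le> T \<and> P \<and> runs w d f (T - 1) Q"
  have "runs w c s 1 (\<lambda>s'. s' = f)"
    using * assms by (auto simp: runs_def)
  then show "runs w (Seq c d) s T Q"
    by (rule runs_Seq) (use * in auto)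
qed

lemma runs_SetConst [simp]:
  "runs w (block (SetConst r k # cs)) s T Q \<longleftrightarrow>
     1 \<le> T \<and> k < 2 ^ w \<and> runs w (block cs) (s\<lparr>reg := (reg s)(r := k)\<rparr>) (T - 1) Q"
  unfolding block.simps
  by (rule runs_Seq_unit) (auto elim: exec_SetConstE intro: exec.intros[simplified])

lemma runs_BinOp [simp]:
  "runs w (block (BinOp f r a b # cs)) s T Q \<longleftrightarrow>
     1 \<le> T \<and> binop_sem f (reg s a) (reg s b) < 2 ^ w \<and>
     runs w (block cs) (s\<lparr>reg := (reg s)(r := binop_sem f (reg s a) (reg s b))\<rparr>) (T - 1) Q"
  unfolding block.simps
  by (rule runs_Seq_unit) (auto elim: exec_BinOpE intro: exec.intros[simplified])

lemma runs_Load [simp]: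
  "runs w (block (Load r a # cs)) s T Q \<longleftrightarrow>
     1 \<le> T \<and> mem s (reg s a) < 2 ^ w \<and>
     runs w (block cs) (s\<lparr>reg := (reg s)(r := mem s (reg s a))\<rparr>) (T - 1) Q"
  unfolding block.simps
  by (rule runs_Seq_unit) (auto elim: exec_LoadE intro: exec.intros[simplified])

lemma runs_Store [simp]:
  "runs w (block (Store a r # cs)) s T Q \<longleftrightarrow>
     1 \<le> T \<and> runs w (block cs) (s\<lparr>mem := (mem s)(reg s a := reg s r)\<rparr>) (T - 1) Q"
  unfolding block.simps
  by (subst runs_Seq_unit[where P = True]) (auto elim: exec_StoreE intro: exec.intros[simplified])

declare block.simps [simp del]

lemma runs_While_step:
  assumes "reg s g \<noteq> 0" and "runs w c s T1 R"
    and "\<And>s1. R s1 \<Longrightarrow> runs w (While g c) s1 T2 Q" and "1 + T1 + T2 \<le> T"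
  shows "runs w (While g c) s T Q"
proof -
  obtain t1 s1 where 1: "t1 \<le> T1" "exec w c s t1 s1" "R s1"
    using assms(2) by (auto simp: runs_def)
  obtain t2 s2 where 2: "t2 \<le> T2" "exec w (While g c) s1 t2 s2" "Q s2"
    using assms(3)[OF 1(3)] by (auto simp: runs_def)
  show ?thesis
    using exec.WhileTrue[OF assms(1) 1(2) 2(2)] by (rule runsI) (use 1 2 assms(4) in auto)
qed

lemma runs_While_done: "reg s g = 0 \<Longrightarrow> Q s \<Longrightarrow> 1 \<le> T \<Longrightarrow> runs w (While g c) s T Q"
  by (rule runsI[OF exec.WhileFalse])

text \<open>The guard register is itself the number of iterations left. Each iteration pays one step
  for its test, and the failing test at the end pays the last step.\<close>

lemma runs_While_count:
  assumes "\<And>k s. I k s \<Longrightarrow> reg s g = k"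
    and "\<And>k s. I (Suc k) s \<Longrightarrow> runs w c s T (I k)"
    and "I k s"
  shows "runs w (While g c) s (k * (T + 1) + 1) (I 0)"
  using assms(3)
proof (induction k arbitrary: s)
  case 0
  then have "exec w (While g c) s 1 s"
    using assms(1) by (intro exec.WhileFalse) blast
  then show ?case
    by (rule runsI) (use 0 in auto)
next
  case (Suc k)
  then obtain t1 s1 where 1: "t1 \<le> T" "exec w c s t1 s1" "I k s1"
    using assms(2) unfolding runs_def by blast
  obtain t2 s2 where 2: "t2 \<le> k * (T + 1) + 1" "exec w (While g c) s1 t2 s2" "I 0 s2"
    using Suc.IH[OF 1(3)] by (auto simp: runs_def)
  have "reg s g \<noteq> 0"
    using assms(1) Suc.prems by fastforce
  from exec.WhileTrue[OF this 1(2) 2(2)] show ?case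
    by (rule runsI) (use 1 2 in auto)
qed

text \<open>The counter runs downwards, so at counter value \<open>k\<close> exactly the cells from
  \<open>A + k\<close> on are filled. \<open>body\<close> may assume the whole memory in this form,
  which makes it accessible to symbolic execution; \<open>X\<close> collects the registers that the
  loop may overwrite.\<close>

lemma runs_fill_loop:
  assumes body: "\<And>k D'. k < K \<Longrightarrow> (\<And>r. r \<notin> X \<Longrightarrow> reg D' r = reg D r) \<Longrightarrow> reg D' g = Suc k \<Longrightarrow>
      coins D' = coins D \<Longrightarrow>
      (\<And>a. mem D' a = (if A + Suc k \<le> a \<and> a < A + K then f (a - A) else mem D a)) \<Longrightarrow>
      runs w c D' T (\<lambda>D''. (\<forall>r. r \<notin> X \<longrightarrow> reg D'' r = reg D' r) \<and> reg D'' g = k \<and>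
        coins D'' = coins D' \<and> mem D'' = (mem D')(A + k := f k))"
    and "reg D g = K"
  shows "runs w (While g c) D (K * (T + 1) + 1)
    (\<lambda>D'. (\<forall>r. r \<notin> X \<longrightarrow> reg D' r = reg D r) \<and> coins D' = coins D \<and>
      mem D' = write_list A (map f [0..<K]) (mem D))"
proof -
  define I where "I = (\<lambda>k (D' :: state). k \<le> K \<and> (\<forall>r. r \<notin> X \<longrightarrow> reg D' r = reg D r) \<and> reg D' g = k \<and>
      coins D' = coins D \<and>
      (\<forall>a. mem D' a = (if A + k \<le> a \<and> a < A + K then f (a - A) else mem D a)))"
  have "runs w (While g c) D (K * (T + 1) + 1) (I 0)"
  proof (rule runs_While_count[where I = I])
    show "runs w c D' T (I k)" if "I (Suc k) D'" for k D'
    proof (rule runs_mono[OF body[of k D']])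
      fix D'' :: state
      assume "(\<forall>r. r \<notin> X \<longrightarrow> reg D'' r = reg D' r) \<and> reg D'' g = k \<and>
        coins D'' = coins D' \<and> mem D'' = (mem D')(A + k := f k)"
      then show "I k D''"
        using that by (auto simp: I_def)
    qed (use that in \<open>auto simp: I_def\<close>)
    show "I K D"
      using assms(2) by (auto simp: I_def)
  qed (auto simp: I_def)
  then show ?thesis
    by (rule runs_mono) (auto simp: I_def write_list_def fun_eq_iff)
qed

section \<open>Relocated programs\<close>

text \<open>
  The OMv programs run inside a driver: their registers are shifted by 32 and their memory starts
  at an address that the driver keeps in register 3. Register 4 is used for address computations.
\<close>

primrec relocate :: "com \<Rightarrow> com" where
  "relocate Skip = Skip"
| "relocate (SetConst r k) = SetConst (r + 32) k"
| "relocate (BinOp f r a b) = BinOp f (r + 32) (a + 32) (b + 32)"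
| "relocate (Load r a) = Seq (BinOp Add 4 3 (a + 32)) (Load (r + 32) 4)"
| "relocate (Store a r) = Seq (BinOp Add 4 3 (a + 32)) (Store 4 (r + 32))"
| "relocate (Flip r) = Flip (r + 32)"
| "relocate (Seq c d) = Seq (relocate c) (relocate d)"
| "relocate (Cond r c d) = Cond (r + 32) (relocate c) (relocate d)"
| "relocate (While r c) = While (r + 32) (relocate c)"

text \<open>\<open>ex\<close> is the surplus of the driver's random tape behind the coins promised
  to the simulated program. It must survive the simulation unread.\<close>

definition simulates :: "nat \<Rightarrow> bool list \<Rightarrow> state \<Rightarrow> state \<Rightarrow> bool" where
  "simulates base ex s D \<longleftrightarrow>
     (\<forall>r. reg D (r + 32) = reg s r) \<and> (\<forall>a. mem D (base + a) = mem s a) \<and> coins D = coins s @ ex"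

definition same_outside :: "nat \<Rightarrow> state \<Rightarrow> state \<Rightarrow> bool" where
  "same_outside base D D' \<longleftrightarrow>
     (\<forall>r < 32. r \<noteq> 4 \<longrightarrow> reg D' r = reg D r) \<and> (\<forall>a < base. mem D' a = mem D a)"

lemma same_outside_trans:
  "same_outside base D D' \<Longrightarrow> same_outside base D' D'' \<Longrightarrow> same_outside base D D''"
  by (auto simp: same_outside_def)

text \<open>Memory accesses become two instructions, hence the factor 2. A base of at most
  \<open>2 ^ W\<close> plus an address below \<open>2 ^ W\<close> stays below
  \<open>2 ^ Suc W\<close>, hence the extra bit. The shift of the registers protects register 3, so
  that the base is still there when the induction hypothesis is applied to a later part of the
  run.\<close>

lemma exec_relocate:
  assumes "exec W c s t s'" and "bounded_state W s" and "simulates base ex s D"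
    and "reg D 3 = base" and "base \<le> 2 ^ W"
  shows "\<exists>t' \<le> 2 * t. \<exists>D'. exec (Suc W) (relocate c) D t' D' \<and>
           simulates base ex s' D' \<and> same_outside base D D'"
  using assms
proof (induction arbitrary: D rule: exec.induct)
  case (Skip s)
  then show ?case
    by (intro exI[of _ 1]) (auto intro!: exec.intros[simplified] exI simp: same_outside_def)
next
  case (SetConst k r s)
  have "exec (Suc W) (relocate (SetConst r k)) D 1 (D\<lparr>reg := (reg D)(r + 32 := k)\<rparr>)"
    using SetConst by (auto intro!: exec.intros(2)[simplified])
  then show ?case
    using SetConst.prems by (intro exI[of _ 1]) (auto simp: simulates_def same_outside_def)
next
  case (BinOp x f s a b r)
  have "exec (Suc W) (relocate (BinOp f r a b)) D 1 (D\<lparr>reg := (reg D)(r + 32 := x)\<rparr>)"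
    unfolding relocate.simps
    by (rule exec.BinOp) (use BinOp in \<open>auto simp: simulates_def\<close>)
  then show ?case
    using BinOp.prems by (intro exI[of _ 1]) (auto simp: simulates_def same_outside_def)
next
  case (Load s a r)
  let ?D1 = "D\<lparr>reg := (reg D)(4 := base + reg s a)\<rparr>"
  have "reg s a < 2 ^ W"
    using Load by (auto simp: bounded_state_def)
  then have "exec (Suc W) (BinOp Add 4 3 (a + 32)) D 1 ?D1"
    by (intro exec.BinOp) (use Load in \<open>auto simp: simulates_def\<close>)
  moreover have "exec (Suc W) (Load (r + 32) 4) ?D1 1
      (?D1\<lparr>reg := (reg ?D1)(r + 32 := mem ?D1 (reg ?D1 4))\<rparr>)"
    by (rule exec.Load) (use Load in \<open>auto simp: simulates_def\<close>)
  ultimately have "exec (Suc W) (relocate (Load r a)) D (1 + 1)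
      (?D1\<lparr>reg := (reg ?D1)(r + 32 := mem ?D1 (reg ?D1 4))\<rparr>)"
    unfolding relocate.simps by (rule exec.Seq)
  then show ?case
    using Load.prems
    by (intro exI[of _ "1 + 1"]) (auto simp: simulates_def same_outside_def intro!: exI)
next
  case (Store a r s)
  let ?D1 = "D\<lparr>reg := (reg D)(4 := base + reg s a)\<rparr>"
  have "reg s a < 2 ^ W"
    using Store by (auto simp: bounded_state_def)
  then have "exec (Suc W) (BinOp Add 4 3 (a + 32)) D 1 ?D1"
    by (intro exec.BinOp) (use Store in \<open>auto simp: simulates_def\<close>)
  from exec.Seq[OF this exec.Store]
  have "exec (Suc W) (relocate (Store a r)) D (1 + 1)
      (?D1\<lparr>mem := (mem ?D1)(reg ?D1 4 := reg ?D1 (r + 32))\<rparr>)"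
    unfolding relocate.simps .
  then show ?case
    using Store.prems
    by (intro exI[of _ "1 + 1"]) (auto simp: simulates_def same_outside_def intro!: exI)
next
  case (Flip s b bs r)
  have "exec (Suc W) (relocate (Flip r)) D 1
      (D\<lparr>reg := (reg D)(r + 32 := of_bool b), coins := bs @ ex\<rparr>)"
    unfolding relocate.simps
    by (rule exec.Flip) (use Flip in \<open>auto simp: simulates_def\<close>)
  then show ?case
    using Flip.prems by (intro exI[of _ 1]) (auto simp: simulates_def same_outside_def)
next
  case (Seq c1 s t1 s1 c2 t2 s2)
  obtain u1 D1 where 1: "u1 \<le> 2 * t1" "exec (Suc W) (relocate c1) D u1 D1"
    "simulates base ex s1 D1" "same_outside base D D1"
    using Seq.IH(1)[OF Seq.prems] by blast
  have "bounded_state W s1"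
    using Seq.hyps(1) Seq.prems(1) by (rule exec_bounded_state)
  moreover have "reg D1 3 = base"
    using 1(4) Seq.prems(3) by (auto simp: same_outside_def)
  ultimately obtain u2 D2 where 2: "u2 \<le> 2 * t2" "exec (Suc W) (relocate c2) D1 u2 D2"
    "simulates base ex s2 D2" "same_outside base D1 D2"
    using Seq.IH(2)[of D1] 1(3) Seq.prems(4) by blast
  have "exec (Suc W) (relocate (Seq c1 c2)) D (u1 + u2) D2"
    using 1(2) 2(2) by (auto intro: exec.Seq)
  moreover have "u1 + u2 \<le> 2 * (t1 + t2)"
    using 1(1) 2(1) by simp
  ultimately show ?case
    using 2(3) same_outside_trans[OF 1(4) 2(4)] by blast
next
  case (CondTrue s r c1 t s1 c2)
  obtain u D1 where 1: "u \<le> 2 * t" "exec (Suc W) (relocate c1) D u D1"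
    "simulates base ex s1 D1" "same_outside base D D1"
    using CondTrue.IH[OF CondTrue.prems] by blast
  have "exec (Suc W) (relocate (Cond r c1 c2)) D (1 + u) D1"
    using CondTrue 1(2) by (auto intro!: exec.CondTrue[simplified] simp: simulates_def)
  moreover have "1 + u \<le> 2 * (1 + t)"
    using 1(1) by simp
  ultimately show ?case
    using 1(3,4) by blast
next
  case (CondFalse s r c2 t s1 c1)
  obtain u D1 where 1: "u \<le> 2 * t" "exec (Suc W) (relocate c2) D u D1"
    "simulates base ex s1 D1" "same_outside base D D1"
    using CondFalse.IH[OF CondFalse.prems] by blast
  have "exec (Suc W) (relocate (Cond r c1 c2)) D (1 + u) D1"
    using CondFalse 1(2) by (auto intro!: exec.CondFalse[simplified] simp: simulates_def)
  moreover have "1 + u \<le> 2 * (1 + t)"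
    using 1(1) by simp
  ultimately show ?case
    using 1(3,4) by blast
next
  case (WhileFalse s r c)
  have "exec (Suc W) (relocate (While r c)) D 1 D"
    using WhileFalse by (auto intro!: exec.WhileFalse[simplified] simp: simulates_def)
  then show ?case
    using WhileFalse.prems by (intro exI[of _ 1]) (auto simp: same_outside_def)
next
  case (WhileTrue s r c t1 s1 t2 s2)
  obtain u1 D1 where 1: "u1 \<le> 2 * t1" "exec (Suc W) (relocate c) D u1 D1"
    "simulates base ex s1 D1" "same_outside base D D1"
    using WhileTrue.IH(1)[OF WhileTrue.prems] by blast
  have "bounded_state W s1"
    using WhileTrue.hyps(2) WhileTrue.prems(1) by (rule exec_bounded_state)
  moreover have "reg D1 3 = base"
    using 1(4) WhileTrue.prems(3) by (auto simp: same_outside_def)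
  ultimately obtain u2 D2 where 2: "u2 \<le> 2 * t2" "exec (Suc W) (relocate (While r c)) D1 u2 D2"
    "simulates base ex s2 D2" "same_outside base D1 D2"
    using WhileTrue.IH(2)[of D1] 1(3) WhileTrue.prems(4) by blast
  have "exec (Suc W) (relocate (While r c)) D (1 + u1 + u2) D2"
    unfolding relocate.simps
    by (rule exec.WhileTrue) (use WhileTrue 1(2) 2(2) in \<open>auto simp: simulates_def\<close>)
  moreover have "1 + u1 + u2 \<le> 2 * (1 + t1 + t2)"
    using 1(1) 2(1) by simp
  ultimately show ?case
    using 2(3) same_outside_trans[OF 1(4) 2(4)] by blast
qed

lemma runs_relocate:
  assumes "exec W c s t s'" and "bounded_state W s" and "simulates base ex s D"
    and "reg D 3 = base" and "base \<le> 2 ^ W"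
  shows "runs (Suc W) (relocate c) D (2 * t)
    (\<lambda>D'. simulates base ex s' D' \<and> same_outside base D D')"
  using exec_relocate[OF assms] by (auto simp: runs_def)

section \<open>Online rounds\<close>

inductive_cases omv_rounds_ConsE: "omv_rounds w Q N s (v # vs) t outs"

abbreviation present_vec :: "nat \<Rightarrow> (nat \<Rightarrow> bool) \<Rightarrow> state \<Rightarrow> state" where
  "present_vec N v s \<equiv> s\<lparr>mem := write_list (1 + N * N) (vec_words N v) (mem s)\<rparr>"

text \<open>
  A query of the driver depends on the earlier answers, whereas \<^const>\<open>solves_omv\<close> is about fixed
  sequences of vectors. The number of rounds that remain is therefore tracked for all continuations
  at once.
\<close>

definition omv_terminates :: "nat \<Rightarrow> com \<Rightarrow> nat \<Rightarrow> state \<Rightarrow> nat \<Rightarrow> nat \<Rightarrow> bool" where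
  "omv_terminates w Q N s k B \<longleftrightarrow>
     (\<forall>vs. length vs = k \<longrightarrow> (\<exists>t \<le> B. \<exists>outs. omv_rounds w Q N s vs t outs))"

text \<open>The universal form is chosen for its negation, which yields a run with a wrong output,
  that is, the event bounded in \<open>solves_omv\<close>. It says nothing if no run exists, so it
  is used together with \<open>omv_terminates\<close>.\<close>

definition omv_correct ::
  "nat \<Rightarrow> com \<Rightarrow> nat \<Rightarrow> (nat \<Rightarrow> nat \<Rightarrow> bool) \<Rightarrow> state \<Rightarrow> (nat \<Rightarrow> bool) list \<Rightarrow> bool" where
  "omv_correct w Q N M s vs \<longleftrightarrow>
     (\<forall>t outs. omv_rounds w Q N s vs t outs \<longrightarrow>
        outs = map (\<lambda>v. vec_words N (bool_mat_vec N M v)) vs)"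

text \<open>The first round does not see the later vectors: by determinism all continuations share
  its time and final state. An arbitrary continuation, here \<open>replicate k v\<close>, serves to
  obtain them.\<close>

lemma omv_terminates_step:
  assumes "omv_terminates w Q N s (Suc k) B"
  obtains t1 s1 where "exec w Q (present_vec N v s) t1 s1" and "t1 \<le> B"
    and "omv_terminates w Q N s1 k (B - t1)"
proof -
  have *: "\<exists>t1 s1 t2 outs. exec w Q (present_vec N v s) t1 s1 \<and>
      omv_rounds w Q N s1 vs t2 outs \<and> t1 + t2 \<le> B" if "length vs = k" for vs
  proof -
    have "length (v # vs) = Suc k"
      using that by simp
    then obtain t outs where "t \<le> B" "omv_rounds w Q N s (v # vs) t outs"
      using assms unfolding omv_terminates_def by blast
    then show ?thesis
      by (auto elim!: omv_rounds_ConsE)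
  qed
  obtain t1 s1 where 1: "exec w Q (present_vec N v s) t1 s1" "t1 \<le> B"
    using *[of "replicate k v"] by force
  have "omv_terminates w Q N s1 k (B - t1)"
    unfolding omv_terminates_def
  proof (intro allI impI)
    fix vs :: "(nat \<Rightarrow> bool) list"
    assume "length vs = k"
    from *[OF this] obtain t1' s1' t2 outs where 2: "exec w Q (present_vec N v s) t1' s1'"
      "omv_rounds w Q N s1' vs t2 outs" "t1' + t2 \<le> B"
      by blast
    with exec_deterministic[OF 1(1) 2(1)]
    show "\<exists>t \<le> B - t1. \<exists>outs. omv_rounds w Q N s1 vs t outs"
      by (intro exI[of _ t2]) auto
  qed
  with 1 that show thesis
    by blast
qed

text \<open>\<open>omv_correct\<close> judges completed runs only. The third assumption provides a
  completion of the remaining rounds, from which the correctness of the first answer can be read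
  off.\<close>

lemma omv_correct_step:
  assumes "omv_correct w Q N M s (v # vs)" and "exec w Q (present_vec N v s) t1 s1"
    and "omv_terminates w Q N s1 (length vs) B"
  shows "\<And>i. i < N \<Longrightarrow> mem s1 (1 + N * N + N + i) = of_bool (bool_mat_vec N M v i)"
    and "omv_correct w Q N M s1 vs"
proof -
  have *: "map (mem s1) [1 + N * N + N ..< 1 + N * N + 2 * N] # outs
      = map (\<lambda>v. vec_words N (bool_mat_vec N M v)) (v # vs)"
    if "omv_rounds w Q N s1 vs t outs" for t outs
    using assms(1) omv_rounds.intros(2)[OF assms(2) that] unfolding omv_correct_def by blast
  obtain t outs where "omv_rounds w Q N s1 vs t outs"
    using assms(3) by (auto simp: omv_terminates_def)
  from *[OF this]
  have out: "map (mem s1) [1 + N * N + N ..< 1 + N * N + 2 * N] = vec_words N (bool_mat_vec N M v)"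
    by simp
  show "mem s1 (1 + N * N + N + i) = of_bool (bool_mat_vec N M v i)" if "i < N" for i
  proof -
    have "mem s1 (1 + N * N + N + i) = map (mem s1) [1 + N * N + N ..< 1 + N * N + 2 * N] ! i"
      using that by (subst nth_map) (auto simp: nth_upt simp del: upt_Suc)
    also have "\<dots> = of_bool (bool_mat_vec N M v i)"
      unfolding out using that by (simp add: vec_words_def)
    finally show ?thesis .
  qed
  show "omv_correct w Q N M s1 vs"
    using * by (auto simp: omv_correct_def)
qed

text \<open>As in \<open>omv_terminates_step\<close>, determinism gives one preprocessing run common
  to all sequences of vectors.\<close>

lemma omv_run_split:
  assumes "\<And>vs. length vs = N \<Longrightarrow> \<exists>t \<le> B. \<exists>outs. omv_run w P Q N M vs bs t outs"
  obtains t s where "exec w P (init_state (omv_input N M) bs) t s" and "t \<le> B"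
    and "omv_terminates w Q N s N (B - t)"
proof -
  have *: "\<exists>t s t' outs. exec w P (init_state (omv_input N M) bs) t s \<and>
      omv_rounds w Q N s vs t' outs \<and> t + t' \<le> B" if "length vs = N" for vs
    using assms[OF that] by (auto simp: omv_run_def)
  obtain t s where 1: "exec w P (init_state (omv_input N M) bs) t s" "t \<le> B"
    using *[of "replicate N (\<lambda>_. False)"] by force
  have "omv_terminates w Q N s N (B - t)"
    unfolding omv_terminates_def
  proof (intro allI impI)
    fix vs :: "(nat \<Rightarrow> bool) list"
    assume "length vs = N"
    from *[OF this] obtain t1 s1 t2 outs where
      2: "exec w P (init_state (omv_input N M) bs) t1 s1" "omv_rounds w Q N s1 vs t2 outs" "t1 + t2 \<le> B"
      by blast
    with exec_deterministic[OF 1(1) 2(1)]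
    show "\<exists>t' \<le> B - t. \<exists>outs. omv_rounds w Q N s vs t' outs"
      by (intro exI[of _ t2]) auto
  qed
  with 1 that show thesis
    by blast
qed

section \<open>Reachable sets of states\<close>

definition nfa_step :: "('q \<times> 'a \<times> 'q) set \<Rightarrow> 'a \<Rightarrow> 'q set \<Rightarrow> 'q set" where
  "nfa_step \<Delta> a S = {q. \<exists>p \<in> S. (p, a, q) \<in> \<Delta>}"

text \<open>Paths are generalised to start anywhere in a set \<open>S\<close>, since reading a
  letter turns one start state into a set. \<open>is_nfa\<close> supplies the condition that all
  visited states belong to \<open>states M\<close>, which the fold does not check.\<close>

lemma accepts_iff_fold:
  assumes "is_nfa M"
  shows "accepts M x \<longleftrightarrow> fold (nfa_step (transitions M)) x {start M} \<inter> final M \<noteq> {}"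
proof -
  have states: "p \<in> states M \<and> q \<in> states M" if "(p, a, q) \<in> transitions M" for p a q
    using assms that by (auto simp: is_nfa_def)
  have *: "(\<exists>q :: nat \<Rightarrow> 'a. q 0 \<in> S \<and> (\<forall>i \<le> length x. q i \<in> states M) \<and>
        (\<forall>i < length x. (q i, x ! i, q (Suc i)) \<in> transitions M) \<and> q (length x) \<in> final M)
      \<longleftrightarrow> fold (nfa_step (transitions M)) x S \<inter> final M \<noteq> {}" for S
  proof (induction x arbitrary: S)
    case Nil
    have "final M \<subseteq> states M"
      using assms by (auto simp: is_nfa_def)
    show ?case
    proof
      assume "fold (nfa_step (transitions M)) [] S \<inter> final M \<noteq> {}"
      then obtain p where "p \<in> S" "p \<in> final M"
        by auto
      with \<open>final M \<subseteq> states M\<close> show "\<exists>q. q 0 \<in> S \<and> (\<forall>i \<le> length []. q i \<in> states M) \<and>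
          (\<forall>i < length []. (q i, [] ! i, q (Suc i)) \<in> transitions M) \<and> q (length []) \<in> final M"
        by (intro exI[of _ "\<lambda>_. p"]) auto
    qed auto
  next
    case (Cons a x)
    let ?path = "\<lambda>q x. (\<forall>i \<le> length x. q i \<in> states M) \<and>
        (\<forall>i < length x. (q i, x ! i, q (Suc i)) \<in> transitions M) \<and> q (length x) \<in> final M"
    have "(\<exists>q. q 0 \<in> S \<and> ?path q (a # x)) \<longleftrightarrow>
        (\<exists>q. q 0 \<in> nfa_step (transitions M) a S \<and> ?path q x)"
    proof
      assume "\<exists>q. q 0 \<in> S \<and> ?path q (a # x)"
      then obtain q where q: "q 0 \<in> S" "?path q (a # x)"
        by blast
      have "?path (q \<circ> Suc) x"
        using q(2) by force
      moreover have "(q \<circ> Suc) 0 \<in> nfa_step (transitions M) a S"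
        using q by (auto simp: nfa_step_def intro!: bexI[of _ "q 0"])
      ultimately show "\<exists>q. q 0 \<in> nfa_step (transitions M) a S \<and> ?path q x"
        by blast
    next
      assume "\<exists>q. q 0 \<in> nfa_step (transitions M) a S \<and> ?path q x"
      then obtain q p where q: "?path q x" "p \<in> S" "(p, a, q 0) \<in> transitions M"
        by (auto simp: nfa_step_def)
      let ?q = "\<lambda>i. case i of 0 \<Rightarrow> p | Suc j \<Rightarrow> q j"
      have "?path ?q (a # x)"
        using q states[OF q(3)] by (auto simp: nth_Cons split: nat.splits)
      then show "\<exists>q. q 0 \<in> S \<and> ?path q (a # x)"
        using q(2) by (intro exI[of _ ?q]) auto
    qed
    also have "\<dots> \<longleftrightarrow> fold (nfa_step (transitions M)) x (nfa_step (transitions M) a S) \<inter> final M \<noteq> {}"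
      by (rule Cons.IH)
    finally show ?case
      by simp
  qed
  show ?thesis
    using *[of "{start M}"] by (simp add: accepts_def)
qed

section \<open>The driver\<close>

text \<open>
  Memory below \<open>base\<close> holds the input, followed from address \<open>cur\<close> on by the current set of states
  as a 0/1 vector of length \<open>n\<close>. Registers: 1 and 2 contain the constants 1 and 0; 3 is \<open>base\<close>;
  5 is \<open>n\<close>; 6 is \<open>N\<close>; 7, 8 and 9 are the addresses of the OMv vector, of the OMv product and of the
  set of states; 10 points to the next unread transition or letter; 12 is the counter of the inner
  loops; 16, 17 and 18 count the remaining final states, transitions and letters; 19 is the address
  of the OMv matrix. Register 2 is never written.
\<close>

definition clear_cell :: com where
  "clear_cell = block [BinOp Sub 12 12 1, BinOp Add 14 12 7, Store 14 2]"

definition copy_in :: com where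
  "copy_in = block [BinOp Sub 12 12 1, BinOp Add 14 12 9, Load 14 14, BinOp Add 15 12 13, Store 15 14]"

text \<open>A wrong answer may consist of arbitrary words. The comparison with 0 normalises them, so
  that the driver always stores a 0/1 vector.\<close>

definition copy_out :: com where
  "copy_out = block [BinOp Sub 12 12 1, BinOp Add 14 12 8, Load 14 14, BinOp Less 14 2 14,
     BinOp Add 15 12 9, Store 15 14]"

text \<open>The vector is cleared in every round because the previous block and whatever
  \<open>Q\<close> wrote there are still in place.\<close>

definition read_letter :: "com \<Rightarrow> com" where
  "read_letter Q = block [Load 13 10, BinOp Add 10 10 1, BinOp Mul 13 13 5, BinOp Add 13 13 7,
     BinOp Add 12 6 2, While 12 clear_cell,
     BinOp Add 12 5 2, While 12 copy_in,
     relocate Q,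
     BinOp Add 12 5 2, While 12 copy_out,
     BinOp Sub 18 18 1]"

definition add_transition :: com where
  "add_transition = block [Load 12 10, BinOp Add 10 10 1, Load 13 10, BinOp Add 10 10 1,
     Load 14 10, BinOp Add 10 10 1, BinOp Mul 14 14 6, BinOp Mul 13 13 5, BinOp Add 12 12 13,
     BinOp Add 12 12 14, BinOp Add 12 12 19, Store 12 1, BinOp Sub 17 17 1]"

text \<open>The constant 6 is the length of the input header. Adding the old register 0 before the
  last comparison forms the disjunction over all final states.\<close>

definition check_final :: com where
  "check_final = block [BinOp Sub 16 16 1, SetConst 14 6, BinOp Add 14 14 16, Load 14 14,
     BinOp Add 14 14 9, Load 14 14, BinOp Add 14 14 0, BinOp Less 0 2 14]"

text \<open>Room for \<open>n\<close> final states is reserved whatever their number. Thus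
  \<open>cur\<close> is \<open>6 + n + 3 m + l\<close>, a bound on the input length that depends on
  the parameters alone.\<close>

definition prepare :: com where
  "prepare = block [SetConst 1 1, Load 5 2, Load 13 1, BinOp Add 14 1 1, Load 15 14,
     SetConst 14 3, Load 16 14, SetConst 14 4, Load 17 14, SetConst 14 5, Load 18 14,
     BinOp Add 6 13 1, BinOp Mul 6 6 5, BinOp Add 6 6 18,
     SetConst 14 6, BinOp Add 10 14 16,
     BinOp Add 9 14 5, BinOp Add 9 9 17, BinOp Add 9 9 17, BinOp Add 9 9 17, BinOp Add 9 9 18,
     BinOp Add 3 9 5, BinOp Add 19 3 1, BinOp Mul 7 6 6, BinOp Add 7 7 19, BinOp Add 8 7 6,
     Store 3 6, BinOp Add 14 9 15, Store 14 1]"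

definition nfa_solver :: "com \<Rightarrow> com \<Rightarrow> com" where
  "nfa_solver P Q = block [prepare, While 17 add_transition, relocate P, While 18 (read_letter Q),
     While 16 check_final]"

abbreviation transition_words :: "(nat \<times> nat \<times> nat) list \<Rightarrow> nat list" where
  "transition_words ts \<equiv> concat (map (\<lambda>(p, a, q). [p, a, q]) ts)"

lemma length_transition_words [simp]: "length (transition_words ts) = 3 * length ts"
  by (induction ts) auto

lemma write_list_bounded:
  "(\<And>a. f a < B) \<Longrightarrow> (\<And>x. x \<in> set xs \<Longrightarrow> x < B) \<Longrightarrow> write_list k xs f a < B"
  by (auto simp: write_list_def)

lemma concat_map_rows:
  "concat (map (\<lambda>i. map (f i) [0..<n]) [0..<m]) = map (\<lambda>k. f (k div n) (k mod n)) [0..<m * n]"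
proof (induction m)
  case (Suc m)
  have "[0..<Suc m * n] = [0..<m * n] @ [m * n..<m * n + n]"
    using upt_add_eq_append[of 0 "m * n" n] by (simp add: add.commute)
  also have "[m * n..<m * n + n] = map (\<lambda>j. j + m * n) [0..<n]"
    using map_add_upt[of "m * n" n] by (simp add: add.commute)
  finally show ?case
    using Suc by (simp del: upt_Suc add: upt_Suc_append)
qed simp

text \<open>Cell 0 holds the dimension, so entries are located by \<open>div\<close> and
  \<open>mod\<close> of \<open>b - 1\<close>. The zeros behind the matrix belong to the initial
  state as well and have to be reproduced above \<open>base\<close>.\<close>

lemma init_omv_mem:
  "mem (init_state (omv_input N M) bs) b =
    (if b = 0 then N else if b \<le> N * N then of_bool (M ((b - 1) div N) ((b - 1) mod N)) else 0)"
proof (cases b)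
  case (Suc k)
  then show ?thesis
    unfolding omv_input_def vec_words_def concat_map_rows init_state_def write_list_def by auto
qed (simp add: omv_input_def init_state_def write_list_def)

section \<open>Memory layout and the encoding of the automaton as a matrix\<close>

text \<open>The conditions under which the address arithmetic is sound: target states fit into the
  rows, the set of states lies below \<open>base\<close>, where relocated programs write nothing,
  and the whole OMv area is addressable with \<open>W\<close> bits.\<close>

locale layout =
  fixes n N cur base W :: nat
  assumes n_le_N: "n \<le> N" and n_pos: "0 < n" and cur_le: "cur + n \<le> base"
    and base_le: "base + 1 + N * N + 2 * N \<le> 2 ^ W"
begin

definition const_regs :: "state \<Rightarrow> bool" where
  "const_regs D \<longleftrightarrow> reg D 1 = 1 \<and> reg D 2 = 0 \<and> reg D 3 = base \<and> reg D 5 = n \<and> reg D 6 = N \<and>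
     reg D 7 = base + 1 + N * N \<and> reg D 8 = base + 1 + N * N + N \<and> reg D 9 = cur"

definition holds :: "nat set \<Rightarrow> state \<Rightarrow> bool" where
  "holds S D \<longleftrightarrow> (\<forall>q < n. mem D (cur + q) = of_bool (q \<in> S))"

text \<open>
  The matrix has one column for each pair of a letter and a state, so that a single OMv instance
  serves all letters; putting the set of states into the block of a letter selects that letter.
\<close>

definition letter_vec :: "nat set \<Rightarrow> nat \<Rightarrow> nat \<Rightarrow> bool" where
  "letter_vec S a j \<longleftrightarrow> (\<exists>p < n. p \<in> S \<and> j = a * n + p)"

lemma letter_vec_iff: "letter_vec S a j \<longleftrightarrow> a * n \<le> j \<and> j < a * n + n \<and> j - a * n \<in> S"
  unfolding letter_vec_def
proof
  assume "a * n \<le> j \<and> j < a * n + n \<and> j - a * n \<in> S"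
  then show "\<exists>p < n. p \<in> S \<and> j = a * n + p"
    by (intro exI[of _ "j - a * n"]) auto
qed auto

definition transition_matrix :: "(nat \<times> nat \<times> nat) set \<Rightarrow> nat \<Rightarrow> nat \<Rightarrow> bool" where
  "transition_matrix \<Delta> q j \<longleftrightarrow> (\<exists>p a. (p, a, q) \<in> \<Delta> \<and> j = a * n + p)"

primrec query_vecs :: "(nat \<times> nat \<times> nat) set \<Rightarrow> nat set \<Rightarrow> nat list \<Rightarrow> (nat \<Rightarrow> bool) list" where
  "query_vecs \<Delta> S [] = []"
| "query_vecs \<Delta> S (a # x) = letter_vec S a # query_vecs \<Delta> (nfa_step \<Delta> a S) x"

lemma length_query_vecs [simp]: "length (query_vecs \<Delta> S x) = length x"
  by (induction x arbitrary: S) auto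

lemma index_unique:
  assumes "a * n + p = a' * n + p'" and "p < n" and "p' < n"
  shows "a = a' \<and> p = p'"
proof -
  have "(a * n + p) div n = (a' * n + p') div n" "(a * n + p) mod n = (a' * n + p') mod n"
    using assms(1) by simp_all
  then show ?thesis
    using assms(2,3) by simp
qed

text \<open>Columns are numbered \<open>a * n + p\<close> with \<open>p < n\<close>, which
  determines \<open>a\<close> and \<open>p\<close>; a vector supported on block \<open>a\<close>
  therefore meets only transitions with letter \<open>a\<close>. The second assumption keeps this
  block inside the vector.\<close>

lemma bool_mat_vec_transition_matrix:
  assumes "\<And>p a q. (p, a, q) \<in> \<Delta> \<Longrightarrow> p < n" and "a * n + n \<le> N"
  shows "bool_mat_vec N (transition_matrix \<Delta>) (letter_vec S a) q \<longleftrightarrow> q \<in> nfa_step \<Delta> a S"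
proof
  assume "bool_mat_vec N (transition_matrix \<Delta>) (letter_vec S a) q"
  then obtain p a' p' where "(p, a', q) \<in> \<Delta>" "p' < n" "p' \<in> S" "a' * n + p = a * n + p'"
    by (auto simp: bool_mat_vec_def transition_matrix_def letter_vec_def)
  moreover from this have "a' = a \<and> p = p'"
    using assms(1) by (intro index_unique) auto
  ultimately show "q \<in> nfa_step \<Delta> a S"
    by (auto simp: nfa_step_def)
next
  assume "q \<in> nfa_step \<Delta> a S"
  then obtain p where p: "p \<in> S" "(p, a, q) \<in> \<Delta>"
    by (auto simp: nfa_step_def)
  moreover have "p < n" "a * n + p < N"
    using assms(1)[OF p(2)] assms(2) by auto
  ultimately show "bool_mat_vec N (transition_matrix \<Delta>) (letter_vec S a) q"
    by (auto simp: bool_mat_vec_def transition_matrix_def letter_vec_def)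
qed

lemma one_less: "1 < (2::nat) ^ W"
  using base_le n_le_N n_pos by linarith

lemma bounded_present_vec:
  "bounded_state W s \<Longrightarrow> bounded_state W (present_vec N v s)"
  using one_less unfolding bounded_state_def
  by (auto intro!: write_list_bounded simp: vec_words_def)

text \<open>The nested \<open>write_list\<close> is the effect of clearing followed by
  \<open>copy_in\<close>; on all \<open>N\<close> vector cells it agrees with the single write by
  which a round presents its vector.\<close>

lemma simulates_present_vec:
  assumes "simulates base ex s D" and "a * n + n \<le> N"
    and "\<And>r. r \<ge> 32 \<Longrightarrow> reg D' r = reg D r" and "coins D' = coins D"
    and "mem D' = write_list (base + 1 + N * N + a * n) (map (\<lambda>q. of_bool (q \<in> S)) [0..<n])
      (write_list (base + 1 + N * N) (map (\<lambda>_. 0) [0..<N]) (mem D))"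
  shows "simulates base ex (present_vec N (letter_vec S a) s) D'"
proof -
  have "mem D' (base + b) = write_list (1 + N * N) (vec_words N (letter_vec S a)) (mem s) b" for b
    using assms(1,2) unfolding assms(5) simulates_def
    by (auto simp: write_list_def vec_words_def letter_vec_iff nth_append)
  with assms show ?thesis
    by (auto simp: simulates_def)
qed

section \<open>Inner loops and the reading of the string\<close>

lemma runs_clear:
  assumes "const_regs D" and "reg D 12 = N"
  shows "runs (Suc W) (While 12 clear_cell) D (N * 5 + 1)
    (\<lambda>D'. (\<forall>r. r \<notin> {12, 14} \<longrightarrow> reg D' r = reg D r) \<and> coins D' = coins D \<and>
      mem D' = write_list (base + 1 + N * N) (map (\<lambda>_. 0) [0..<N]) (mem D))"
proof -
  have "runs (Suc W) (While 12 clear_cell) D (N * (4 + 1) + 1)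
    (\<lambda>D'. (\<forall>r. r \<notin> {12, 14} \<longrightarrow> reg D' r = reg D r) \<and> coins D' = coins D \<and>
      mem D' = write_list (base + 1 + N * N) (map (\<lambda>_. 0) [0..<N]) (mem D))"
    by (rule runs_fill_loop)
      (use assms base_le in \<open>auto simp: clear_cell_def const_regs_def add_ac\<close>)
  then show ?thesis
    by simp
qed

lemma runs_copy_in:
  assumes "const_regs D" and "reg D 12 = n" and "reg D 13 = base + 1 + N * N + a * n"
    and "a * n + n \<le> N" and "holds S D"
  shows "runs (Suc W) (While 12 copy_in) D (n * 7 + 1)
    (\<lambda>D'. (\<forall>r. r \<notin> {12, 14, 15} \<longrightarrow> reg D' r = reg D r) \<and> coins D' = coins D \<and>
      mem D' = write_list (base + 1 + N * N + a * n) (map (\<lambda>q. of_bool (q \<in> S)) [0..<n]) (mem D))"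
proof -
  have "1 < (2::nat) ^ W"
    using base_le n_le_N n_pos by linarith
  then have "runs (Suc W) (While 12 copy_in) D (n * (6 + 1) + 1)
    (\<lambda>D'. (\<forall>r. r \<notin> {12, 14, 15} \<longrightarrow> reg D' r = reg D r) \<and> coins D' = coins D \<and>
      mem D' = write_list (base + 1 + N * N + a * n) (map (\<lambda>q. of_bool (q \<in> S)) [0..<n]) (mem D))"
    by (intro runs_fill_loop)
      (use assms base_le cur_le in \<open>auto simp: copy_in_def const_regs_def holds_def add_ac\<close>)
  then show ?thesis
    by simp
qed

lemma runs_copy_out:
  assumes "const_regs D" and "reg D 12 = n" and "simulates base ex s D" and "bounded_state W s"
  shows "runs (Suc W) (While 12 copy_out) D (n * 8 + 1)
    (\<lambda>D'. (\<forall>r. r \<notin> {12, 14, 15} \<longrightarrow> reg D' r = reg D r) \<and> coins D' = coins D \<and>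
      mem D' = write_list cur (map (\<lambda>q. of_bool (0 < mem s (1 + N * N + N + q))) [0..<n]) (mem D))"
proof -
  have *: "mem D (Suc (base + (k + (N + N * N)))) = mem s (Suc (k + (N + N * N)))" for k
    using assms(3) unfolding simulates_def by (metis add_Suc_right)
  have "1 < (2::nat) ^ W"
    using base_le n_le_N n_pos by linarith
  moreover have "mem s k < 2 * 2 ^ W" for k
    using assms(4) unfolding bounded_state_def by (simp add: trans_less_add1 mult_2)
  ultimately have "runs (Suc W) (While 12 copy_out) D (n * (7 + 1) + 1)
    (\<lambda>D'. (\<forall>r. r \<notin> {12, 14, 15} \<longrightarrow> reg D' r = reg D r) \<and> coins D' = coins D \<and>
      mem D' = write_list cur (map (\<lambda>q. of_bool (0 < mem s (1 + N * N + N + q))) [0..<n]) (mem D))"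
    by (intro runs_fill_loop)
      (use assms(1,2) base_le cur_le n_le_N * in \<open>auto simp: copy_out_def const_regs_def add_ac\<close>)
  then show ?thesis
    by simp
qed

text \<open>Nothing is assumed about the correctness of the answer: the new set is whatever
  \<open>Q\<close> left in the answer cells. The three loops cost 5, 7 and 8 steps per cell, which
  \<open>n \<le> N\<close> turns into \<open>20 * N\<close>.\<close>

lemma runs_read_letter:
  assumes "const_regs D" and "simulates base ex s D" and "holds S D" and "bounded_state W s"
    and "reg D 10 < cur" and "mem D (reg D 10) = a" and "a * n + n \<le> N" and "reg D 18 = Suc k"
    and "k \<le> N" and "exec W Q (present_vec N (letter_vec S a) s) t s1"
  shows "runs (Suc W) (read_letter Q) D (2 * t + 20 * N + 20)
    (\<lambda>D'. const_regs D' \<and> simulates base ex s1 D' \<and> holds {q. 0 < mem s1 (1 + N * N + N + q)} D' \<and>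
      reg D' 10 = Suc (reg D 10) \<and> reg D' 18 = k \<and> reg D' 16 = reg D 16 \<and> reg D' 0 = reg D 0 \<and>
      (\<forall>b < cur. mem D' b = mem D b))" (is "runs _ _ _ _ ?post")
proof -
  have bounds: "1 < (2::nat) ^ W" "base + 1 + N * N + 2 * N \<le> 2 ^ W" "cur + n \<le> base" "n \<le> N"
    using one_less base_le cur_le n_le_N by auto
  have "a \<le> a * n"
    using n_pos by simp
  then have a_le: "a \<le> N" "a * n \<le> N"
    using assms(7) by linarith+
  define D1 where "D1 = D\<lparr>reg := (reg D)(10 := Suc (reg D 10),
    13 := base + 1 + N * N + a * n, 12 := N)\<rparr>"
  have bounded_s1: "bounded_state W s1"
    using assms(10) bounded_present_vec[OF assms(4)] by (rule exec_bounded_state)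
  have "runs (Suc W) (block [While 12 clear_cell, BinOp Add 12 5 2, While 12 copy_in, relocate Q,
      BinOp Add 12 5 2, While 12 copy_out, BinOp Sub 18 18 1]) D1
      ((N * 5 + 1) + (1 + ((n * 7 + 1) + (2 * t + (1 + ((n * 8 + 1) + 2)))))) ?post"
  proof (rule runs_Cons[OF runs_clear])
    show "const_regs D1" "reg D1 12 = N"
      using assms(1) by (auto simp: D1_def const_regs_def)
    fix D2 :: state
    assume "(\<forall>r. r \<notin> {12, 14} \<longrightarrow> reg D2 r = reg D1 r) \<and> coins D2 = coins D1 \<and>
      mem D2 = write_list (base + 1 + N * N) (map (\<lambda>_. 0) [0..<N]) (mem D1)"
    then have D2: "\<And>r. r \<notin> {12, 14} \<Longrightarrow> reg D2 r = reg D1 r" "coins D2 = coins D1"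
      "mem D2 = write_list (base + 1 + N * N) (map (\<lambda>_. 0) [0..<N]) (mem D1)"
      by auto
    define D3 where "D3 = D2\<lparr>reg := (reg D2)(12 := n)\<rparr>"
    have "runs (Suc W) (block [While 12 copy_in, relocate Q,
      BinOp Add 12 5 2, While 12 copy_out, BinOp Sub 18 18 1]) D3
      ((n * 7 + 1) + (2 * t + (1 + ((n * 8 + 1) + 2)))) ?post"
    proof (rule runs_Cons[OF runs_copy_in])
      show "const_regs D3"
        using assms(1) by (auto simp: D3_def D2 D1_def const_regs_def)
      show "reg D3 12 = n" "reg D3 13 = base + 1 + N * N + a * n" "a * n + n \<le> N"
        using assms(7) by (auto simp: D3_def D2 D1_def)
      show "holds S D3"
        using assms(3) bounds by (auto simp: holds_def D3_def D2 D1_def write_list_def)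
      fix D4 :: state
      assume D4: "(\<forall>r. r \<notin> {12, 14, 15} \<longrightarrow> reg D4 r = reg D3 r) \<and> coins D4 = coins D3 \<and>
        mem D4 = write_list (base + 1 + N * N + a * n) (map (\<lambda>q. of_bool (q \<in> S)) [0..<n]) (mem D3)"
      show "runs (Suc W) (block [relocate Q, BinOp Add 12 5 2, While 12 copy_out, BinOp Sub 18 18 1])
        D4 (2 * t + (1 + ((n * 8 + 1) + 2))) ?post"
      proof (rule runs_Cons[OF runs_relocate[OF assms(10)]])
        show "bounded_state W (present_vec N (letter_vec S a) s)"
          using assms(4) by (rule bounded_present_vec)
        show "simulates base ex (present_vec N (letter_vec S a) s) D4"
          by (rule simulates_present_vec[OF assms(2,7)])
            (use D4 in \<open>auto simp: D3_def D2 D1_def\<close>)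
        show "reg D4 3 = base" "base \<le> 2 ^ W"
          using D4 assms(1) bounds by (auto simp: D3_def D2 D1_def const_regs_def)
        fix D5
        assume "simulates base ex s1 D5 \<and> same_outside base D4 D5"
        then have sim5: "simulates base ex s1 D5"
          and D5: "\<And>r. r < 32 \<Longrightarrow> r \<noteq> 4 \<Longrightarrow> reg D5 r = reg D4 r" "\<And>b. b < base \<Longrightarrow> mem D5 b = mem D4 b"
          by (auto simp: same_outside_def)
        define D6 where "D6 = D5\<lparr>reg := (reg D5)(12 := n)\<rparr>"
        have sim6: "simulates base ex s1 D6"
          using sim5 by (auto simp: D6_def simulates_def)
        have regs6: "const_regs D6" "reg D6 12 = n" "reg D6 10 = Suc (reg D 10)"
          "reg D6 18 = Suc k" "reg D6 16 = reg D 16" "reg D6 0 = reg D 0"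
          using assms(1,8) by (auto simp: D6_def D5 D4 D3_def D2 D1_def const_regs_def)
        have mem6: "mem D6 b = mem D b" if "b < base" for b
          using that D4 by (auto simp: D6_def D5 D3_def D2 D1_def write_list_def)
        have "runs (Suc W) (block [While 12 copy_out, BinOp Sub 18 18 1]) D6 ((n * 8 + 1) + 2) ?post"
        proof (rule runs_Cons[OF runs_copy_out[OF regs6(1,2) sim6 bounded_s1]])
          fix D7 :: state
          assume D7: "(\<forall>r. r \<notin> {12, 14, 15} \<longrightarrow> reg D7 r = reg D6 r) \<and> coins D7 = coins D6 \<and>
            mem D7 = write_list cur (map (\<lambda>q. of_bool (0 < mem s1 (1 + N * N + N + q))) [0..<n]) (mem D6)"
          have "simulates base ex s1 D7"
            using sim6 D7 bounds by (auto simp: simulates_def write_list_def)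
          moreover have "k < 2 * 2 ^ W"
            using assms(9) bounds by linarith
          ultimately show "runs (Suc W) (block [BinOp Sub 18 18 1]) D7 2 ?post"
            using D7 regs6 mem6 bounds
            by (auto simp: const_regs_def simulates_def holds_def write_list_def)
        qed simp
        then show "runs (Suc W) (block [BinOp Add 12 5 2, While 12 copy_out, BinOp Sub 18 18 1])
          D5 (1 + ((n * 8 + 1) + 2)) ?post"
          using regs6(1) bounds by (simp add: D6_def const_regs_def)
      qed simp
    qed simp
    then show "runs (Suc W) (block [BinOp Add 12 5 2, While 12 copy_in, relocate Q,
      BinOp Add 12 5 2, While 12 copy_out, BinOp Sub 18 18 1]) D2
      (1 + ((n * 7 + 1) + (2 * t + (1 + ((n * 8 + 1) + 2))))) ?post"
      using assms(1) bounds by (simp add: D3_def D2 D1_def const_regs_def)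
  qed simp
  then have "runs (Suc W) (block [While 12 clear_cell, BinOp Add 12 5 2, While 12 copy_in, relocate Q,
      BinOp Add 12 5 2, While 12 copy_out, BinOp Sub 18 18 1]) D1 (2 * t + 20 * N + 15) ?post"
    by (rule runs_mono) (use bounds in auto)
  then show ?thesis
    unfolding read_letter_def
    using assms(1,5,6) bounds a_le by (simp add: D1_def const_regs_def ac_simps)
qed

text \<open>Time and layout are guaranteed for every behaviour of the OMv algorithm; correctness
  appears only as an implication about the final set. The vectors \<open>us\<close> stand for the
  rounds that are left when the string ends. \<open>B\<close> is a budget for all remaining rounds,
  so the time of each round is subtracted from it and the simulation costs \<open>2 * B\<close> in
  total.\<close>

lemma runs_letters:
  assumes "omv_terminates w Q N s k B" and "w \<le> W" and "length x \<le> k" and "k \<le> N"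
    and "const_regs D" and "simulates base ex s D" and "holds S D" and "bounded_state W s"
    and "reg D 18 = length x" and "reg D 10 + length x \<le> cur"
    and "\<And>i. i < length x \<Longrightarrow> mem D (reg D 10 + i) = x ! i"
    and "\<And>a. a \<in> set x \<Longrightarrow> a * n + n \<le> N"
    and "\<And>p a q. (p, a, q) \<in> \<Delta> \<Longrightarrow> p < n"
  shows "runs (Suc W) (While 18 (read_letter Q)) D (2 * B + length x * (20 * N + 21) + 1)
    (\<lambda>D'. const_regs D' \<and> reg D' 16 = reg D 16 \<and> reg D' 0 = reg D 0 \<and>
      (\<forall>b < cur. mem D' b = mem D b) \<and>
      (\<exists>S'. holds S' D' \<and>
        (\<forall>us. length x + length us = k \<longrightarrow>
           omv_correct w Q N (transition_matrix \<Delta>) s (query_vecs \<Delta> S x @ us) \<longrightarrow>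
           S' = fold (nfa_step \<Delta>) x S)))" (is "runs _ _ _ _ (?post s D S x k)")
  using assms(1,3-12)
proof (induction x arbitrary: s k B D S)
  case Nil
  then show ?case
    by (intro runs_While_done) auto
next
  case (Cons a x)
  obtain k' where k: "k = Suc k'"
    using Cons.prems(2) by (cases k) auto
  obtain t1 s1 where 1: "exec w Q (present_vec N (letter_vec S a) s) t1 s1" "t1 \<le> B"
    "omv_terminates w Q N s1 k' (B - t1)"
    using omv_terminates_step Cons.prems(1) unfolding k by blast
  have exec_W: "exec W Q (present_vec N (letter_vec S a) s) t1 s1"
    using 1(1) \<open>w \<le> W\<close> by (rule exec_mono)
  \<comment> \<open>The cells behind the first \<open>n\<close> answers may contain anything, so the
    set read off need not equal the true successor set even if all relevant answers are right.
    \<open>holds\<close> looks only below \<open>n\<close>; hence \<open>S1\<close> can be the true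
    set whenever both agree there, which gives the equality that the fold requires.\<close>
  define S1 where "S1 = (if \<forall>q < n. 0 < mem s1 (1 + N * N + N + q) \<longleftrightarrow> q \<in> nfa_step \<Delta> a S
    then nfa_step \<Delta> a S else {q. 0 < mem s1 (1 + N * N + N + q)})"
  have holds_S1: "holds S1 D'" if "holds {q. 0 < mem s1 (1 + N * N + N + q)} D'" for D'
    using that by (auto simp: holds_def S1_def)
  have a: "a * n + n \<le> N"
    using Cons.prems(11) by simp
  have x: "reg D 10 < cur" "mem D (reg D 10) = a"
    using Cons.prems(9) Cons.prems(10)[of 0] by auto
  show ?case
  proof (rule runs_While_step)
    show "reg D 18 \<noteq> 0"
      using Cons.prems(8) by simp
    show "runs (Suc W) (read_letter Q) D (2 * t1 + 20 * N + 20)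
      (\<lambda>D'. const_regs D' \<and> simulates base ex s1 D' \<and> holds {q. 0 < mem s1 (1 + N * N + N + q)} D' \<and>
        reg D' 10 = Suc (reg D 10) \<and> reg D' 18 = length x \<and> reg D' 16 = reg D 16 \<and>
        reg D' 0 = reg D 0 \<and> (\<forall>b < cur. mem D' b = mem D b))"
      by (rule runs_read_letter[OF Cons.prems(4-7) x a _ _ exec_W]) (use Cons.prems in auto)
    show "1 + (2 * t1 + 20 * N + 20) + (2 * (B - t1) + length x * (20 * N + 21) + 1)
      \<le> 2 * B + length (a # x) * (20 * N + 21) + 1"
      using 1(2) by simp
    fix D1
    assume D1: "const_regs D1 \<and> simulates base ex s1 D1 \<and>
      holds {q. 0 < mem s1 (1 + N * N + N + q)} D1 \<and> reg D1 10 = Suc (reg D 10) \<and>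
      reg D1 18 = length x \<and> reg D1 16 = reg D 16 \<and> reg D1 0 = reg D 0 \<and>
      (\<forall>b < cur. mem D1 b = mem D b)"
    have "runs (Suc W) (While 18 (read_letter Q)) D1 (2 * (B - t1) + length x * (20 * N + 21) + 1)
      (?post s1 D1 S1 x k')"
    proof (rule Cons.IH[OF 1(3)])
      show "bounded_state W s1"
        using exec_W bounded_present_vec[OF Cons.prems(7)] by (rule exec_bounded_state)
      show "mem D1 (reg D1 10 + i) = x ! i" if "i < length x" for i
        using that D1 Cons.prems(9) Cons.prems(10)[of "Suc i"] by auto
      show "holds S1 D1"
        using D1 holds_S1 by blast
    qed (use D1 Cons.prems k in auto)
    then show "runs (Suc W) (While 18 (read_letter Q)) D1
      (2 * (B - t1) + length x * (20 * N + 21) + 1) (?post s D S (a # x) k)"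
    proof (rule runs_mono[OF _ order_refl])
      fix D'
      assume D': "?post s1 D1 S1 x k' D'"
      then obtain S' where S': "holds S' D'"
        "\<And>us. length x + length us = k' \<Longrightarrow>
           omv_correct w Q N (transition_matrix \<Delta>) s1 (query_vecs \<Delta> S1 x @ us) \<Longrightarrow>
           S' = fold (nfa_step \<Delta>) x S1"
        by blast
      have "S' = fold (nfa_step \<Delta>) (a # x) S" if "length (a # x) + length us = k"
        "omv_correct w Q N (transition_matrix \<Delta>) s (query_vecs \<Delta> S (a # x) @ us)" for us
      proof -
        have *: "omv_correct w Q N (transition_matrix \<Delta>) s
            (letter_vec S a # query_vecs \<Delta> (nfa_step \<Delta> a S) x @ us)"
          "omv_terminates w Q N s1 (length (query_vecs \<Delta> (nfa_step \<Delta> a S) x @ us)) (B - t1)"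
          using that 1(3) k by auto
        note step = omv_correct_step[OF *(1) 1(1) *(2)]
        have "mem s1 (1 + N * N + N + q) = of_bool (q \<in> nfa_step \<Delta> a S)" if "q < n" for q
          using step(1)[of q] that n_le_N bool_mat_vec_transition_matrix[OF assms(13) a] by simp
        then have "S1 = nfa_step \<Delta> a S"
          by (auto simp: S1_def)
        with S'(2)[of us] step(2) that k show ?thesis
          by simp
      qed
      with S'(1) D' D1 show "?post s D S (a # x) k D'"
        by auto
    qed
  qed
qed

section \<open>Building the matrix, testing final states and initialisation\<close>

text \<open>The written cell lies in row \<open>q\<close> of the matrix, and
  \<open>q < n \<le> N\<close> keeps this row inside it, so no address overflows. A transition costs
  13 instructions, the \<open>Skip\<close> of the block and the loop test.\<close>

lemma runs_add_transitions:
  assumes "const_regs D" and "reg D 19 = base + 1" and "reg D 17 = length ts" and "length ts \<le> base"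
    and "reg D 10 + 3 * length ts \<le> cur"
    and "\<And>i. i < 3 * length ts \<Longrightarrow> mem D (reg D 10 + i) = transition_words ts ! i"
    and "\<And>p a q. (p, a, q) \<in> set ts \<Longrightarrow> p < n \<and> q < n \<and> a * n + n \<le> N"
  shows "runs (Suc W) (While 17 add_transition) D (15 * length ts + 1)
    (\<lambda>D'. (\<forall>r. r \<notin> {10, 12, 13, 14, 17} \<longrightarrow> reg D' r = reg D r) \<and> coins D' = coins D \<and>
      reg D' 10 = reg D 10 + 3 * length ts \<and>
      mem D' = (\<lambda>b. if \<exists>p a q. (p, a, q) \<in> set ts \<and> b = base + 1 + (q * N + (a * n + p))
                    then 1 else mem D b))"
  using assms
proof (induction ts arbitrary: D)
  case Nil
  then show ?case
    by (intro runs_While_done) auto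
next
  case (Cons tr ts)
  obtain p a q where tr: "tr = (p, a, q)"
    by (cases tr)
  have triple: "p < n" "q < n" "a * n + n \<le> N"
    using Cons.prems(7)[of p a q] by (auto simp: tr)
  have "a \<le> a * n"
    using n_pos by simp
  then have "a \<le> N"
    using triple(3) by linarith
  moreover have "q * N + N \<le> N * N"
    using triple(2) n_le_N mult_le_mono1[of "Suc q" N N] by auto
  ultimately have bounds: "1 < (2::nat) ^ W" "base + 1 + N * N + 2 * N \<le> 2 ^ W" "cur + n \<le> base" "n \<le> N"
    "a \<le> N" "a * n \<le> N" "q * N + N \<le> N * N"
    using triple one_less base_le cur_le n_le_N by auto
  have words: "mem D (reg D 10) = p" "mem D (Suc (reg D 10)) = a" "mem D (Suc (Suc (reg D 10))) = q"
    using Cons.prems(6)[of 0] Cons.prems(6)[of 1] Cons.prems(6)[of 2] by (auto simp: tr)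
  let ?i = "base + 1 + (q * N + (a * n + p))"
  let ?R = "\<lambda>D'. (\<forall>r. r \<notin> {10, 12, 13, 14, 17} \<longrightarrow> reg D' r = reg D r) \<and> coins D' = coins D \<and>
      reg D' 10 = reg D 10 + 3 \<and> reg D' 17 = length ts \<and> mem D' = (mem D)(?i := 1)"
  show ?case
  proof (rule runs_While_step[where R = ?R])
    show "reg D 17 \<noteq> 0"
      using Cons.prems(3) by simp
    show "runs (Suc W) add_transition D 14 ?R"
      unfolding add_transition_def
      using Cons.prems(1-5) words triple bounds by (simp add: const_regs_def ac_simps)
    show "1 + 14 + (15 * length ts + 1) \<le> 15 * length (tr # ts) + 1"
      by simp
    fix D1 :: state
    assume D1: "?R D1"
    show "runs (Suc W) (While 17 add_transition) D1 (15 * length ts + 1)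
      (\<lambda>D'. (\<forall>r. r \<notin> {10, 12, 13, 14, 17} \<longrightarrow> reg D' r = reg D r) \<and> coins D' = coins D \<and>
        reg D' 10 = reg D 10 + 3 * length (tr # ts) \<and>
        mem D' = (\<lambda>b. if \<exists>p a q. (p, a, q) \<in> set (tr # ts) \<and> b = base + 1 + (q * N + (a * n + p))
                      then 1 else mem D b))"
    proof (rule runs_mono[OF Cons.IH order_refl])
      show "const_regs D1" "reg D1 19 = base + 1" "reg D1 17 = length ts" "length ts \<le> base"
        "reg D1 10 + 3 * length ts \<le> cur"
        using D1 Cons.prems by (auto simp: const_regs_def)
      show "p < n \<and> q < n \<and> a * n + n \<le> N" if "(p, a, q) \<in> set ts" for p a q
        using Cons.prems(7) that by auto
      show "mem D1 (reg D1 10 + i) = transition_words ts ! i" if "i < 3 * length ts" for i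
        using that D1 Cons.prems(5) Cons.prems(6)[of "3 + i"] bounds(3) by (auto simp: tr ac_simps)
    next
      fix D' :: state
      assume D': "(\<forall>r. r \<notin> {10, 12, 13, 14, 17} \<longrightarrow> reg D' r = reg D1 r) \<and> coins D' = coins D1 \<and>
        reg D' 10 = reg D1 10 + 3 * length ts \<and>
        mem D' = (\<lambda>b. if \<exists>p a q. (p, a, q) \<in> set ts \<and> b = base + 1 + (q * N + (a * n + p))
                      then 1 else mem D1 b)"
      then have "mem D' b = (if \<exists>p a q. (p, a, q) \<in> set (tr # ts) \<and> b = base + 1 + (q * N + (a * n + p))
                      then 1 else mem D b)" for b
      proof -
        have merge: "(if A then x else if B then x else y) = (if A \<or> B then x else y)" for A B and x y :: nat
          by simp
        have "mem D' b = (if (\<exists>p a q. (p, a, q) \<in> set ts \<and> b = base + 1 + (q * N + (a * n + p))) \<or> b = ?i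
                      then 1 else mem D b)"
          using D' D1 by (simp only: fun_upd_def merge)
        moreover have "(\<exists>p a q. (p, a, q) \<in> set (tr # ts) \<and> b = base + 1 + (q * N + (a * n + p))) \<longleftrightarrow>
            (\<exists>p a q. (p, a, q) \<in> set ts \<and> b = base + 1 + (q * N + (a * n + p))) \<or> b = ?i"
          by (auto simp: tr)
        ultimately show ?thesis
          by presburger
      qed
      with D' D1 show "(\<forall>r. r \<notin> {10, 12, 13, 14, 17} \<longrightarrow> reg D' r = reg D r) \<and> coins D' = coins D \<and>
        reg D' 10 = reg D 10 + 3 * length (tr # ts) \<and>
        mem D' = (\<lambda>b. if \<exists>p a q. (p, a, q) \<in> set (tr # ts) \<and> b = base + 1 + (q * N + (a * n + p))
                      then 1 else mem D b)"
        by auto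
    qed
  qed
qed

text \<open>Register 16 counts down, so the list is scanned from its end and the invariant refers to
  \<open>drop k fs\<close>.\<close>

lemma runs_check_final:
  assumes "const_regs D" and "holds S D" and "reg D 0 = 0" and "reg D 16 = length fs"
    and "length fs + 6 \<le> cur"
    and "\<And>i. i < length fs \<Longrightarrow> mem D (6 + i) = fs ! i" and "\<And>q. q \<in> set fs \<Longrightarrow> q < n"
  shows "runs (Suc W) (While 16 check_final) D (10 * length fs + 1)
    (\<lambda>D'. reg D' 0 = of_bool (S \<inter> set fs \<noteq> {}))"
proof -
  define I where "I = (\<lambda>k (D' :: state). k \<le> length fs \<and> reg D' 16 = k \<and> const_regs D' \<and> mem D' = mem D \<and>
    reg D' 0 = of_bool (S \<inter> set (drop k fs) \<noteq> {}))"
  have "runs (Suc W) (While 16 check_final) D (length fs * (9 + 1) + 1) (I 0)"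
  proof (rule runs_While_count[where I = I])
    fix k and D' :: state
    assume I: "I (Suc k) D'"
    then have k: "k < length fs"
      by (simp add: I_def)
    have "fs ! k < n" "mem D (cur + fs ! k) = of_bool (fs ! k \<in> S)"
      using assms(2,7) k by (auto simp: holds_def)
    moreover have "drop k fs = fs ! k # drop (Suc k) fs"
      using k by (simp add: Cons_nth_drop_Suc)
    moreover have "mem D (6 + k) = fs ! k"
      using assms(6) k by simp
    ultimately show "runs (Suc W) check_final D' 9 (I k)"
      using I k assms(5) one_less base_le cur_le n_pos unfolding check_final_def I_def
      by (auto simp: const_regs_def ac_simps)
  qed (use assms in \<open>auto simp: I_def\<close>)
  then show ?thesis
    by (rule runs_mono) (auto simp: I_def)
qed

lemma runs_prepare:
  assumes N: "N = (k + 1) * n + l" and cur: "cur = 6 + n + 3 * m + l" and base: "base = cur + n"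
    and "F \<le> n" and "p < n" and inp: "inp = [n, k, p, F, m, l] @ rest"
  shows "runs (Suc W) prepare (init_state inp bs) 40
    (\<lambda>D. const_regs D \<and> reg D 0 = 0 \<and> reg D 10 = 6 + F \<and> reg D 16 = F \<and> reg D 17 = m \<and>
       reg D 18 = l \<and> reg D 19 = base + 1 \<and> (\<forall>r \<ge> 32. reg D r = 0) \<and> coins D = bs \<and>
       mem D = (write_list 0 inp (\<lambda>_. 0))(base := N, cur + p := 1))"
proof -
  have "k \<le> k * n"
    using n_pos by simp
  moreover have "k * n + n + l = N"
    using N by simp
  ultimately have "k \<le> N" "k * n + n + l = N"
    by linarith+
  then have bounds: "1 < (2::nat) ^ W" "base + 1 + N * N + 2 * N \<le> 2 ^ W" "n \<le> N"
    "k \<le> N" "k * n + n + l = N"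
    using one_less base_le n_le_N by auto
  have header: "write_list 0 inp (\<lambda>_. 0) 0 = n" "write_list 0 inp (\<lambda>_. 0) (Suc 0) = k"
    "write_list 0 inp (\<lambda>_. 0) (Suc (Suc 0)) = p" "write_list 0 inp (\<lambda>_. 0) 3 = F"
    "write_list 0 inp (\<lambda>_. 0) 4 = m" "write_list 0 inp (\<lambda>_. 0) 5 = l"
    unfolding inp by (auto simp: write_list_def)
  show ?thesis
    unfolding prepare_def init_state_def const_regs_def
    using bounds assms(4,5) cur base
    by (simp add: header ac_simps)
qed

text \<open>\<open>f\<close> is the memory before the transitions are entered. As it is zero above
  \<open>base\<close>, writing only the ones yields the complete OMv input, and division with
  remainder by \<open>N\<close> recovers target and column from an address.\<close>

lemma simulates_initial:
  assumes "\<And>p a q. (p, a, q) \<in> \<Delta> \<Longrightarrow> p < n \<and> q < n \<and> a * n + n \<le> N"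
    and "\<And>r. r \<ge> 32 \<Longrightarrow> reg D r = 0" and "coins D = bs @ ex"
    and "mem D = (\<lambda>b. if \<exists>p a q. (p, a, q) \<in> \<Delta> \<and> b = base + 1 + (q * N + (a * n + p))
                      then 1 else f b)"
    and "\<And>b. f (base + b) = (if b = 0 then N else 0)"
  shows "simulates base ex (init_state (omv_input N (transition_matrix \<Delta>)) bs) D"
proof -
  have mem: "mem D (base + b) = mem (init_state (omv_input N (transition_matrix \<Delta>)) bs) b" for b
  proof (cases b)
    case 0
    then show ?thesis
      by (simp add: init_omv_mem assms(4)) (use assms(5)[of 0] in simp)
  next
    case (Suc j)
    have "(\<exists>p a q. (p, a, q) \<in> \<Delta> \<and> j = q * N + (a * n + p)) \<longleftrightarrow>
        j < N * N \<and> transition_matrix \<Delta> (j div N) (j mod N)"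
    proof
      assume "\<exists>p a q. (p, a, q) \<in> \<Delta> \<and> j = q * N + (a * n + p)"
      then obtain p a q where tr: "(p, a, q) \<in> \<Delta>" "j = q * N + (a * n + p)"
        by blast
      have lt: "a * n + p < N" "q < N"
        using assms(1)[OF tr(1)] n_le_N by auto
      then have "j div N = q" "j mod N = a * n + p"
        using tr(2) by simp_all
      moreover have "q * N + N \<le> N * N"
        using lt(2) mult_le_mono1[of "Suc q" N N] by auto
      ultimately show "j < N * N \<and> transition_matrix \<Delta> (j div N) (j mod N)"
        using tr lt by (auto simp: transition_matrix_def)
    next
      assume "j < N * N \<and> transition_matrix \<Delta> (j div N) (j mod N)"
      then obtain p a where "(p, a, j div N) \<in> \<Delta>" "j mod N = a * n + p"
        by (auto simp: transition_matrix_def)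
      then show "\<exists>p a q. (p, a, q) \<in> \<Delta> \<and> j = q * N + (a * n + p)"
        by (metis div_mult_mod_eq)
    qed
    moreover have "f (base + Suc j) = 0"
      using assms(5)[of "Suc j"] by simp
    ultimately show ?thesis
      unfolding init_omv_mem assms(4) Suc by (auto simp del: One_nat_def)
  qed
  show ?thesis
    unfolding simulates_def using mem assms(2,3) by (auto simp: init_state_def)
qed

section \<open>The complete run of the driver\<close>

text \<open>The hypothesis of the postcondition concerns one sequence that is determined by
  automaton and string and padded to \<open>N\<close> vectors. \<open>bs\<close> are the coins of
  the OMv algorithm; the driver itself flips none, so \<open>ex\<close> is never read.\<close>

lemma runs_nfa_solver:
  fixes M :: "(nat, nat) nfa"
  assumes N: "N = (k + 1) * n + l" and cur: "cur = 6 + n + 3 * m + l" and base: "base = cur + n"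
    and M: "is_nfa M" "states M = {..<n}" "alphabet M = {..<k}" "card (transitions M) = m"
    and x: "set x \<subseteq> alphabet M" "length x = l" and inp: "nfa_encoding M x inp"
    and "w \<le> W"
    and P: "exec w P (init_state (omv_input N (transition_matrix (transitions M))) bs) t s"
    and Q: "omv_terminates w Q N s N B"
  shows "runs (Suc W) (nfa_solver P Q) (init_state inp (bs @ ex))
    (2 * (t + B) + 15 * m + l * (20 * N + 21) + 10 * n + 50)
    (\<lambda>D. omv_correct w Q N (transition_matrix (transitions M)) s
           (query_vecs (transitions M) {start M} x @ replicate (N - l) (\<lambda>_. False)) \<longrightarrow>
         reg D 0 = of_bool (accepts M x))"
proof -
  let ?\<Delta> = "transitions M"
  let ?s0 = "init_state (omv_input N (transition_matrix ?\<Delta>)) bs"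
  obtain fs ts where fs: "distinct fs" "set fs = final M" and ts: "distinct ts" "set ts = ?\<Delta>"
    and inp_eq: "inp = [n, k, start M, length fs, length ts, length x] @ fs @ transition_words ts @ x"
    using inp M(2,3) by (auto simp: nfa_encoding_def)
  have "final M \<subseteq> {..<n}" and start: "start M < n"
    using M(1,2) by (auto simp: is_nfa_def)
  then have fs_lt: "q < n" if "q \<in> set fs" for q
    using that fs by auto
  have "length fs \<le> n"
    using distinct_card[OF fs(1)] fs(2) card_mono[OF _ \<open>final M \<subseteq> {..<n}\<close>] by simp
  have len_ts: "length ts = m"
    using distinct_card[OF ts(1)] ts(2) M(4) by simp
  have letter: "a * n + n \<le> N" if "a < k" for a
  proof -
    have "Suc a * n \<le> k * n"
      using that by (intro mult_le_mono1) simp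
    then show ?thesis
      unfolding N by (simp add: algebra_simps)
  qed
  have tr: "p < n \<and> q < n \<and> a * n + n \<le> N" if "(p, a, q) \<in> ?\<Delta>" for p a q
    using that M(1-3) letter by (auto simp: is_nfa_def)
  have cells: "write_list 0 inp (\<lambda>_. 0) (6 + i) =
      (fs @ transition_words ts @ x) ! i" if "i < length fs + 3 * m + l" for i
    using that x(2) len_ts by (simp add: inp_eq write_list_def nth_append)
  have len_inp: "length inp = 6 + length fs + 3 * m + l"
    using x(2) len_ts by (simp add: inp_eq)
  have zero: "write_list 0 inp (\<lambda>_. 0) b = 0" if "cur \<le> b" for b
    using that len_inp \<open>length fs \<le> n\<close> by (simp add: write_list_def cur)
  \<comment> \<open>The memory between \<open>prepare\<close> and the matrix construction: the
    input, the dimension at \<open>base\<close>, and the singleton of the start state at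
    \<open>cur\<close>.\<close>
  define f where "f = (write_list 0 inp (\<lambda>_. 0))(base := N, cur + start M := 1)"
  have f_base: "f (base + b) = (if b = 0 then N else 0)" for b
    using zero[of "base + b"] start by (simp add: f_def base)
  have f_low: "f b = write_list 0 inp (\<lambda>_. 0) b" if "b < cur" for b
    using that by (simp add: f_def base)
  have "holds {start M} D" if "\<And>b. b < base \<Longrightarrow> mem D b = f b" for D
    using that zero cur_le n_pos by (auto simp: holds_def base f_def)
  note holds_start = this
  let ?post = "\<lambda>D. omv_correct w Q N (transition_matrix ?\<Delta>) s
           (query_vecs ?\<Delta> {start M} x @ replicate (N - l) (\<lambda>_. False)) \<longrightarrow>
         reg D 0 = of_bool (accepts M x)"
  let ?time = "40 + ((15 * m + 1) + (2 * t + ((2 * B + l * (20 * N + 21) + 1) + ((10 * length fs + 1) + 1))))"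
  have bounded_s: "bounded_state W s"
  proof (rule exec_bounded_state)
    show "exec W P ?s0 t s"
      using P \<open>w \<le> W\<close> by (rule exec_mono)
    show "bounded_state W ?s0"
      using one_less base_le unfolding bounded_state_def init_omv_mem
      by (auto simp: init_state_def)
  qed
  have "runs (Suc W) (nfa_solver P Q) (init_state inp (bs @ ex)) ?time ?post"
    unfolding nfa_solver_def
  proof (rule runs_Cons[OF runs_prepare[OF N cur base \<open>length fs \<le> n\<close> start]])
    show "inp = [n, k, start M, length fs, m, l] @ fs @ transition_words ts @ x"
      using inp_eq len_ts x(2) by simp
    fix D1
    assume D1: "const_regs D1 \<and> reg D1 0 = 0 \<and> reg D1 10 = 6 + length fs \<and> reg D1 16 = length fs \<and>
      reg D1 17 = m \<and> reg D1 18 = l \<and> reg D1 19 = base + 1 \<and> (\<forall>r \<ge> 32. reg D1 r = 0) \<and>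
      coins D1 = bs @ ex \<and> mem D1 = (write_list 0 inp (\<lambda>_. 0))(base := N, cur + start M := 1)"
    have mem1: "mem D1 = f"
      using D1 by (simp add: f_def)
    have "runs (Suc W) (While 17 add_transition) D1 (15 * length ts + 1)
    (\<lambda>D'. (\<forall>r. r \<notin> {10, 12, 13, 14, 17} \<longrightarrow> reg D' r = reg D1 r) \<and> coins D' = coins D1 \<and>
      reg D' 10 = reg D1 10 + 3 * length ts \<and>
      mem D' = (\<lambda>b. if \<exists>p a q. (p, a, q) \<in> set ts \<and> b = base + 1 + (q * N + (a * n + p))
                    then 1 else mem D1 b))"
    proof (rule runs_add_transitions)
      show "mem D1 (reg D1 10 + i) = transition_words ts ! i" if "i < 3 * length ts" for i
      proof -
        have "mem D1 (reg D1 10 + i) = write_list 0 inp (\<lambda>_. 0) (6 + (length fs + i))"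
        proof -
          have "6 + (length fs + i) < cur"
            using that \<open>length fs \<le> n\<close> len_ts n_pos unfolding cur by linarith
          then show ?thesis
            using D1 f_low[of "6 + (length fs + i)"] by (simp add: add.assoc mem1)
        qed
        also have "\<dots> = transition_words ts ! i"
          using that len_ts by (subst cells) (auto simp: nth_append)
        finally show ?thesis .
      qed
      show "p < n \<and> q < n \<and> a * n + n \<le> N" if "(p, a, q) \<in> set ts" for p a q
        using that tr ts(2) by simp
    qed (use D1 len_ts cur base \<open>length fs \<le> n\<close> in auto)
    then show "runs (Suc W) (block [While 17 add_transition, relocate P, While 18 (read_letter Q),
      While 16 check_final]) D1
      ((15 * m + 1) + (2 * t + ((2 * B + l * (20 * N + 21) + 1) + ((10 * length fs + 1) + 1)))) ?post"
      unfolding len_ts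
    proof (rule runs_Cons)
      fix D2 :: state
      assume "(\<forall>r. r \<notin> {10, 12, 13, 14, 17} \<longrightarrow> reg D2 r = reg D1 r) \<and> coins D2 = coins D1 \<and>
        reg D2 10 = reg D1 10 + 3 * m \<and>
        mem D2 = (\<lambda>b. if \<exists>p a q. (p, a, q) \<in> set ts \<and> b = base + 1 + (q * N + (a * n + p))
                      then 1 else mem D1 b)"
      then have D2: "\<And>r. r \<notin> {10, 12, 13, 14, 17} \<Longrightarrow> reg D2 r = reg D1 r" "coins D2 = coins D1"
        "reg D2 10 = 6 + length fs + 3 * m"
        "mem D2 = (\<lambda>b. if \<exists>p a q. (p, a, q) \<in> ?\<Delta> \<and> b = base + 1 + (q * N + (a * n + p))
                      then 1 else f b)"
        using D1 ts(2) unfolding mem1 by auto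
      have sim2: "simulates base ex ?s0 D2"
        using tr _ _ D2(4) f_base by (rule simulates_initial) (use D1 D2(1,2) in auto)
      have const2: "const_regs D2"
        using D1 D2(1) by (simp add: const_regs_def)
      show "runs (Suc W) (block [relocate P, While 18 (read_letter Q), While 16 check_final]) D2
        (2 * t + ((2 * B + l * (20 * N + 21) + 1) + ((10 * length fs + 1) + 1))) ?post"
      proof (rule runs_Cons[OF runs_relocate[OF exec_mono[OF P \<open>w \<le> W\<close>] _ sim2]])
        show "bounded_state W ?s0"
          using one_less base_le unfolding bounded_state_def init_omv_mem
          by (auto simp: init_state_def)
        show "reg D2 3 = base" "base \<le> 2 ^ W"
          using const2 base_le by (auto simp: const_regs_def)
        fix D3
        assume "simulates base ex s D3 \<and> same_outside base D2 D3"
        then have sim3: "simulates base ex s D3"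
          and D3: "\<And>r. r < 32 \<Longrightarrow> r \<noteq> 4 \<Longrightarrow> reg D3 r = reg D2 r" "\<And>b. b < base \<Longrightarrow> mem D3 b = f b"
          using D2(4) by (auto simp: same_outside_def)
        have const3: "const_regs D3"
          using const2 by (simp add: const_regs_def D3)
        have regs3: "reg D3 10 = 6 + length fs + 3 * m" "reg D3 18 = l" "reg D3 16 = length fs"
          "reg D3 0 = 0"
          using D1 by (simp_all add: D3 D2)
        have low3: "mem D3 b = write_list 0 inp (\<lambda>_. 0) b" if "b < cur" for b
          using that f_low by (simp add: D3 base)
        have "runs (Suc W) (While 18 (read_letter Q)) D3 (2 * B + length x * (20 * N + 21) + 1)
          (\<lambda>D'. const_regs D' \<and> reg D' 16 = reg D3 16 \<and> reg D' 0 = reg D3 0 \<and>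
            (\<forall>b < cur. mem D' b = mem D3 b) \<and>
            (\<exists>S'. holds S' D' \<and>
              (\<forall>us. length x + length us = N \<longrightarrow>
                 omv_correct w Q N (transition_matrix ?\<Delta>) s (query_vecs ?\<Delta> {start M} x @ us) \<longrightarrow>
                 S' = fold (nfa_step ?\<Delta>) x {start M})))"
        proof (rule runs_letters[OF Q \<open>w \<le> W\<close> _ order_refl const3 sim3])
          show "mem D3 (reg D3 10 + i) = x ! i" if "i < length x" for i
          proof -
            have "mem D3 (reg D3 10 + i) = write_list 0 inp (\<lambda>_. 0) (6 + (length fs + 3 * m + i))"
              using that x(2) \<open>length fs \<le> n\<close> by (simp add: regs3 low3 cur add.assoc)
            also have "\<dots> = x ! i"
              using that len_ts x(2) by (subst cells) (auto simp: nth_append)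
            finally show ?thesis .
          qed
          show "a * n + n \<le> N" if "a \<in> set x" for a
            using that x(1) M(3) letter by auto
          show "length x \<le> N"
            using N x(2) by simp
          show "holds {start M} D3"
            using D3(2) by (rule holds_start)
        qed (use bounded_s regs3 x(2) cur \<open>length fs \<le> n\<close> tr in auto)
        then show "runs (Suc W) (block [While 18 (read_letter Q), While 16 check_final]) D3
          ((2 * B + l * (20 * N + 21) + 1) + ((10 * length fs + 1) + 1)) ?post"
          unfolding x(2)
        proof (rule runs_Cons)
          fix D4
          assume D4: "const_regs D4 \<and> reg D4 16 = reg D3 16 \<and> reg D4 0 = reg D3 0 \<and>
            (\<forall>b < cur. mem D4 b = mem D3 b) \<and>
            (\<exists>S'. holds S' D4 \<and>
              (\<forall>us. l + length us = N \<longrightarrow>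
                 omv_correct w Q N (transition_matrix ?\<Delta>) s (query_vecs ?\<Delta> {start M} x @ us) \<longrightarrow>
                 S' = fold (nfa_step ?\<Delta>) x {start M}))"
          then obtain S' where S': "holds S' D4"
            "\<And>us. l + length us = N \<Longrightarrow>
                 omv_correct w Q N (transition_matrix ?\<Delta>) s (query_vecs ?\<Delta> {start M} x @ us) \<Longrightarrow>
                 S' = fold (nfa_step ?\<Delta>) x {start M}"
            by blast
          have "runs (Suc W) (While 16 check_final) D4 (10 * length fs + 1)
            (\<lambda>D'. reg D' 0 = of_bool (S' \<inter> set fs \<noteq> {}))"
          proof (rule runs_check_final[OF _ S'(1)])
            show "mem D4 (6 + i) = fs ! i" if "i < length fs" for i
              using that D4 low3[of "6 + i"] cells[of i] \<open>length fs \<le> n\<close>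
              by (simp add: cur nth_append)
          qed (use D4 regs3 fs_lt cur \<open>length fs \<le> n\<close> in auto)
          then show "runs (Suc W) (block [While 16 check_final]) D4 ((10 * length fs + 1) + 1) ?post"
          proof (rule runs_Cons)
            fix D5 :: state
            assume D5: "reg D5 0 = of_bool (S' \<inter> set fs \<noteq> {})"
            have "l \<le> N"
              by (simp add: N)
            then have "S' = fold (nfa_step ?\<Delta>) x {start M}"
              if "omv_correct w Q N (transition_matrix ?\<Delta>) s
                (query_vecs ?\<Delta> {start M} x @ replicate (N - l) (\<lambda>_. False))"
              using that by (intro S'(2)) auto
            then show "runs (Suc W) (block []) D5 1 ?post"
              using D5 fs(2) accepts_iff_fold[OF M(1)] by simp
          qed simp
        qed simp
      qed simp
    qed simp
  qed simp
  then show ?thesis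
    by (rule runs_mono) (use \<open>length fs \<le> n\<close> in auto)
qed

end

section \<open>Coin flips\<close>

lemma coin_prob_eq: "coin_prob N P = card {bs. length bs = N \<and> P bs} / 2 ^ N"
proof -
  have lists: "finite {bs :: bool list. length bs = N}" "card {bs :: bool list. length bs = N} = 2 ^ N"
    using finite_lists_length_eq[of "UNIV :: bool set" N] card_lists_length_eq[of "UNIV :: bool set" N]
    by (simp_all add: card_UNIV_bool)
  moreover have "{bs :: bool list. length bs = N} \<noteq> {}"
    using Ex_list_of_length[of N] by auto
  moreover have "{bs. length bs = N} \<inter> {bs. P bs} = {bs. length bs = N \<and> P bs}"
    by auto
  ultimately show ?thesis
    unfolding coin_prob_def by (simp add: measure_pmf_of_set)
qed

lemma coin_prob_mono:
  assumes "\<And>bs. length bs = N \<Longrightarrow> P bs \<Longrightarrow> Q bs"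
  shows "coin_prob N P \<le> coin_prob N Q"
proof -
  have "finite {bs :: bool list. length bs = N}"
    using finite_lists_length_eq[of "UNIV :: bool set" N] by simp
  then have "card {bs. length bs = N \<and> P bs} \<le> card {bs. length bs = N \<and> Q bs}"
    using assms by (intro card_mono) auto
  then show ?thesis
    by (simp add: coin_prob_eq divide_right_mono)
qed

text \<open>Each prefix has the same number \<open>2 ^ K\<close> of extensions, so a prefix of a
  uniform tape is uniform. This transfers the error bound from the shorter tape of the OMv algorithm
  to that of the driver.\<close>

lemma coin_prob_take: "coin_prob (N + K) (\<lambda>bs. P (take N bs)) = coin_prob N P"
proof -
  have "bij_betw (\<lambda>(xs, ys). xs @ ys) ({bs. length bs = N \<and> P bs} \<times> {bs. length bs = K})
      {bs. length bs = N + K \<and> P (take N bs)}"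
    by (rule bij_betw_byWitness[where f' = "\<lambda>bs. (take N bs, drop N bs)"]) auto
  then have "card {bs. length bs = N + K \<and> P (take N bs)} =
      card {bs. length bs = N \<and> P bs} * card {bs :: bool list. length bs = K}"
    using bij_betw_same_card by (fastforce simp: card_cartesian_product)
  moreover have "card {bs :: bool list. length bs = K} = 2 ^ K"
    using card_lists_length_eq[of "UNIV :: bool set" K] by (simp add: card_UNIV_bool)
  ultimately show ?thesis
    by (simp add: coin_prob_eq power_add)
qed

section \<open>The reduction\<close>

definition omv_size :: "(nat \<Rightarrow> nat) \<Rightarrow> (nat \<Rightarrow> nat) \<Rightarrow> nat \<Rightarrow> nat" where
  "omv_size l \<sigma> n = (\<sigma> n + 1) * n + l n"

definition solver_time :: "(nat \<Rightarrow> nat) \<Rightarrow> (nat \<Rightarrow> nat) \<Rightarrow> (nat \<Rightarrow> nat) \<Rightarrow> (nat \<Rightarrow> nat) \<Rightarrow> nat \<Rightarrow> nat" where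
  "solver_time T m l \<sigma> n =
     2 * T (omv_size l \<sigma> n) + 15 * m n + l n * (20 * omv_size l \<sigma> n + 21) + 10 * n + 50"

text \<open>This is \<open>base + 1 + N * N + 2 * N\<close> with
  \<open>base = 6 + 2 * n + 3 * m n + l n\<close>, the bound required by
  \<open>layout\<close>.\<close>

definition memory_bound :: "(nat \<Rightarrow> nat) \<Rightarrow> (nat \<Rightarrow> nat) \<Rightarrow> (nat \<Rightarrow> nat) \<Rightarrow> nat \<Rightarrow> nat" where
  "memory_bound m l \<sigma> n = 7 + 2 * n + 3 * m n + l n +
     omv_size l \<sigma> n * omv_size l \<sigma> n + 2 * omv_size l \<sigma> n"

text \<open>For each tape, a wrong answer of the driver forces a wrong OMv run on the fixed sequence
  \<open>?vs\<close> with the first \<open>T N\<close> coins. The error probability of at most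
  \<open>1 / 3\<close> is therefore inherited.\<close>

lemma decides_nfa_solver:
  assumes omv: "solves_omv P Q T w" and W: "\<And>n. memory_bound m l \<sigma> n \<le> 2 ^ W n"
    and "\<And>n. w (omv_size l \<sigma> n) \<le> W n"
  shows "decides_nfa_acceptance (nfa_solver P Q) m l \<sigma> (solver_time T m l \<sigma>) (\<lambda>n. Suc (W n))"
  unfolding decides_nfa_acceptance_def
proof (intro allI impI)
  fix n M x inp
  assume "0 < n" and "is_nfa M \<and> states M = {..<n} \<and> alphabet M = {..<\<sigma> n} \<and>
    card (transitions M) = m n \<and> set x \<subseteq> alphabet M \<and> length x = l n \<and> nfa_encoding M x inp"
  then have M: "is_nfa M" "states M = {..<n}" "alphabet M = {..<\<sigma> n}" "card (transitions M) = m n"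
    and x: "set x \<subseteq> alphabet M" "length x = l n" and inp: "nfa_encoding M x inp"
    by auto
  define N where "N = omv_size l \<sigma> n"
  define cur where "cur = 6 + n + 3 * m n + l n"
  interpret layout n N cur "cur + n" "W n"
    by unfold_locales
      (use \<open>0 < n\<close> W[of n] in \<open>auto simp: cur_def N_def omv_size_def memory_bound_def\<close>)
  let ?A = "transition_matrix (transitions M)"
  let ?vs = "query_vecs (transitions M) {start M} x @ replicate (N - l n) (\<lambda>_. False)"
  let ?time = "solver_time T m l \<sigma> n"
  define K where "K = ?time - T N"
  have time: "?time = T N + K"
    by (simp add: K_def solver_time_def N_def)
  have "0 < N" and "l n \<le> N"
    using \<open>0 < n\<close> by (auto simp: N_def omv_size_def)
  then have len_vs: "length ?vs = N"
    using x(2) by simp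
  let ?wrong = "\<lambda>bs. \<exists>t outs. omv_run (w N) P Q N ?A ?vs bs t outs \<and>
    outs \<noteq> map (\<lambda>v. vec_words N (bool_mat_vec N ?A v)) ?vs"
  \<comment> \<open>The failure event is a disjunct of the postcondition, so every tape gets a
    halting run, including those on which the OMv algorithm errs.\<close>
  have run: "runs (Suc (W n)) (nfa_solver P Q) (init_state inp bs) ?time
      (\<lambda>D. ?wrong (take (T N) bs) \<or> reg D 0 = of_bool (accepts M x))" if "length bs = ?time" for bs
  proof -
    have "length (take (T N) bs) = T N"
      using that time by simp
    then have "\<exists>t \<le> T N. \<exists>outs. omv_run (w N) P Q N ?A vs (take (T N) bs) t outs"
      if "length vs = N" for vs
      using omv \<open>0 < N\<close> that unfolding solves_omv_def by blast
    then obtain t s where s: "exec (w N) P (init_state (omv_input N ?A) (take (T N) bs)) t s"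
      "t \<le> T N" "omv_terminates (w N) Q N s N (T N - t)"
      by (rule omv_run_split)
    have "runs (Suc (W n)) (nfa_solver P Q) (init_state inp (take (T N) bs @ drop (T N) bs))
      (2 * (t + (T N - t)) + 15 * m n + l n * (20 * N + 21) + 10 * n + 50)
      (\<lambda>D. omv_correct (w N) Q N ?A s ?vs \<longrightarrow> reg D 0 = of_bool (accepts M x))"
      by (rule runs_nfa_solver[OF _ cur_def refl M x inp _ s(1,3)])
        (use assms(3)[of n] in \<open>auto simp: N_def omv_size_def\<close>)
    moreover have "2 * (t + (T N - t)) + 15 * m n + l n * (20 * N + 21) + 10 * n + 50 = ?time"
      using s(2) by (simp add: solver_time_def N_def)
    ultimately have "runs (Suc (W n)) (nfa_solver P Q) (init_state inp bs) ?time
      (\<lambda>D. omv_correct (w N) Q N ?A s ?vs \<longrightarrow> reg D 0 = of_bool (accepts M x))"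
      by (simp only: append_take_drop_id)
    then show ?thesis
    proof (rule runs_mono[OF _ order_refl])
      fix D
      assume D: "omv_correct (w N) Q N ?A s ?vs \<longrightarrow> reg D 0 = of_bool (accepts M x)"
      show "?wrong (take (T N) bs) \<or> reg D 0 = of_bool (accepts M x)"
      proof (cases "omv_correct (w N) Q N ?A s ?vs")
        case False
        then obtain t' outs where "omv_rounds (w N) Q N s ?vs t' outs"
          "outs \<noteq> map (\<lambda>v. vec_words N (bool_mat_vec N ?A v)) ?vs"
          unfolding omv_correct_def by blast
        moreover from this have "omv_run (w N) P Q N ?A ?vs (take (T N) bs) (t + t') outs"
          using s(1) unfolding omv_run_def by blast
        ultimately show ?thesis
          by blast
      qed (use D in blast)
    qed
  qed
  show "(\<forall>bs. length bs = ?time \<longrightarrow> (\<exists>t \<le> ?time. \<exists>s. exec (Suc (W n)) (nfa_solver P Q) (init_state inp bs) t s)) \<and>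
    coin_prob ?time (\<lambda>bs. \<exists>t s. exec (Suc (W n)) (nfa_solver P Q) (init_state inp bs) t s \<and>
      reg s 0 \<noteq> of_bool (accepts M x)) \<le> 1 / 3"
  proof
    show "\<forall>bs. length bs = ?time \<longrightarrow> (\<exists>t \<le> ?time. \<exists>s. exec (Suc (W n)) (nfa_solver P Q) (init_state inp bs) t s)"
      using run unfolding runs_def by blast
    have "coin_prob ?time (\<lambda>bs. \<exists>t s. exec (Suc (W n)) (nfa_solver P Q) (init_state inp bs) t s \<and>
        reg s 0 \<noteq> of_bool (accepts M x)) \<le> coin_prob (T N + K) (\<lambda>bs. ?wrong (take (T N) bs))"
      unfolding time
    proof (rule coin_prob_mono)
      fix bs
      assume bs: "length bs = T N + K" and "\<exists>t s. exec (Suc (W n)) (nfa_solver P Q) (init_state inp bs) t s \<and>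
        reg s 0 \<noteq> of_bool (accepts M x)"
      then obtain t s where s: "exec (Suc (W n)) (nfa_solver P Q) (init_state inp bs) t s"
        "reg s 0 \<noteq> of_bool (accepts M x)"
        by blast
      obtain t' D where "exec (Suc (W n)) (nfa_solver P Q) (init_state inp bs) t' D"
        "?wrong (take (T N) bs) \<or> reg D 0 = of_bool (accepts M x)"
        using run[of bs] bs unfolding time runs_def by blast
      with s show "?wrong (take (T N) bs)"
        using exec_deterministic by blast
    qed
    also have "\<dots> = coin_prob (T N) ?wrong"
      by (rule coin_prob_take)
    also have "\<dots> \<le> 1 / 3"
      using omv \<open>0 < N\<close> len_vs unfolding solves_omv_def by blast
    finally show "coin_prob ?time (\<lambda>bs. \<exists>t s. exec (Suc (W n)) (nfa_solver P Q) (init_state inp bs) t s \<and>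
      reg s 0 \<noteq> of_bool (accepts M x)) \<le> 1 / 3" .
  qed
qed

section \<open>Growth rates\<close>

lemma ln_bigo_of_polynomial:
  fixes f :: "nat \<Rightarrow> nat"
  assumes "(\<lambda>n. real (f n)) \<in> O(\<lambda>n. real n powr c)" and "\<And>n. 0 < n \<Longrightarrow> 1 \<le> f n"
  shows "(\<lambda>n. ln (real (f n))) \<in> O(\<lambda>n. ln (real n))"
proof -
  obtain C where C: "0 < C" "\<forall>\<^sub>F n in at_top. norm (real (f n)) \<le> C * norm (real n powr c)"
    using assms(1) by (elim landau_o.bigE)
  have "\<forall>\<^sub>F n in at_top. norm (ln (real (f n))) \<le> (1 + \<bar>c\<bar>) * norm (ln (real n))"
    \<comment> \<open>The threshold gives \<open>C \<le> n\<close>, so the constant contributes at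
      most \<open>ln n\<close>.\<close>
    using C(2) eventually_ge_at_top[of "nat \<lceil>C\<rceil> + 1"]
  proof eventually_elim
    case (elim n)
    have n: "C \<le> n" "1 \<le> real n"
      using elim(2) by linarith+
    have f: "1 \<le> real (f n)"
      using assms(2)[of n] n by simp
    have "ln (real (f n)) \<le> ln (C * real n powr c)"
      using elim(1) f by (subst ln_le_cancel_iff) auto
    also have "\<dots> = ln C + c * ln (real n)"
      using C(1) n by (simp add: ln_mult ln_powr)
    also have "\<dots> \<le> ln (real n) + \<bar>c\<bar> * ln (real n)"
      using C(1) n by (intro add_mono mult_right_mono) auto
    finally show ?case
      using f n by (simp add: algebra_simps)
  qed
  then show ?thesis
    by (rule bigoI)
qed

lemma powr_bigo_nat: "a \<le> b \<Longrightarrow> (\<lambda>n. real n powr a) \<in> O(\<lambda>n. real n powr b)"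
  by (subst powr_bigo_iff) (auto simp: filterlim_real_sequentially)

lemma one_bigo_powr: "0 \<le> b \<Longrightarrow> (\<lambda>_. 1) \<in> O(\<lambda>n. real n powr b)"
  by (intro bigoI[of _ 1] eventually_mono[OF eventually_ge_at_top[of 1]])
    (simp add: ge_one_powr_ge_zero)

lemma one_bigo_ln: "(\<lambda>_. 1) \<in> O(\<lambda>n. ln (real n))"
proof (intro bigoI[of _ 1] eventually_mono[OF eventually_ge_at_top[of 3]])
  fix n :: nat
  assume "3 \<le> n"
  then have "exp 1 \<le> real n"
    using exp_le by linarith
  then have "1 \<le> ln (real n)"
    using \<open>3 \<le> n\<close> by (subst ln_ge_iff) auto
  then show "norm (1 :: real) \<le> 1 * norm (ln (real n))"
    by simp
qed

lemma subpolynomial_bigo: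
  assumes "subpolynomial \<sigma>" and "0 < \<delta>"
  shows "(\<lambda>n. real (\<sigma> n)) \<in> O(\<lambda>n. real n powr \<delta>)"
proof -
  obtain e :: "nat \<Rightarrow> real" where e: "e \<in> o(\<lambda>_. 1)" "\<forall>\<^sub>F n in at_top. real (\<sigma> n) = real n powr e n"
    using assms(1) by (auto simp: subpolynomial_def)
  have "\<forall>\<^sub>F n in at_top. norm (e n) \<le> \<delta> * norm (1 :: real)"
    using e(1) assms(2) by (rule landau_o.smallD)
  then have "\<forall>\<^sub>F n in at_top. norm (real (\<sigma> n)) \<le> 1 * norm (real n powr \<delta>)"
    using e(2) eventually_ge_at_top[of 1]
    by eventually_elim (auto intro!: powr_mono)
  then show ?thesis
    by (rule bigoI)
qed

lemma omv_size_bigo: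
  assumes "(\<lambda>n. real (l n)) \<in> O(\<lambda>n. real n powr 1)"
    and "(\<lambda>n. real (\<sigma> n)) \<in> O(\<lambda>n. real n powr \<delta>)" and "0 < \<delta>"
  shows "(\<lambda>n. real (omv_size l \<sigma> n)) \<in> O(\<lambda>n. real n powr (1 + \<delta>))"
proof -
  have "(\<lambda>n. real (\<sigma> n) + 1) \<in> O(\<lambda>n. real n powr \<delta>)"
    using assms(2,3) by (intro sum_in_bigo one_bigo_powr) auto
  moreover have "(\<lambda>n. real n) \<in> O(\<lambda>n. real n powr 1)"
    by simp
  ultimately have "(\<lambda>n. (real (\<sigma> n) + 1) * real n) \<in> O(\<lambda>n. real n powr \<delta> * real n powr 1)"
    by (rule landau_o.big.mult)
  then have "(\<lambda>n. (real (\<sigma> n) + 1) * real n) \<in> O(\<lambda>n. real n powr (1 + \<delta>))"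
    by (simp only: powr_add[symmetric] add.commute)
  moreover have "(\<lambda>n. real (l n)) \<in> O(\<lambda>n. real n powr (1 + \<delta>))"
    using assms(1) powr_bigo_nat[of 1 "1 + \<delta>"] \<open>0 < \<delta>\<close> by (auto intro: landau_o.big_trans)
  ultimately have "(\<lambda>n. (real (\<sigma> n) + 1) * real n + real (l n)) \<in> O(\<lambda>n. real n powr (1 + \<delta>))"
    by (rule sum_in_bigo)
  then show ?thesis
    by (simp add: omv_size_def algebra_simps)
qed

lemma omv_size_ge: "n \<le> omv_size l \<sigma> n"
  by (simp add: omv_size_def)

text \<open>Needed to substitute \<open>N\<close> into the asymptotic bounds on \<open>T\<close> and
  \<open>w\<close>, which are stated in terms of the dimension.\<close>

lemma filterlim_omv_size: "filterlim (omv_size l \<sigma>) at_top at_top"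
  by (rule filterlim_at_top_mono[OF filterlim_ident]) (simp add: omv_size_ge)

text \<open>The OMv part has exponent \<open>(1 + \<delta>) * (3 - 6 * \<delta>) = 3 - 3 * \<delta>
  - 6 * \<delta> * \<delta>\<close>: half of the saving \<open>6 * \<delta>\<close> pays for the
  growth of \<open>N\<close> beyond \<open>n\<close>. The condition
  \<open>6 * \<delta> \<le> 1\<close> keeps the target exponent above \<open>2 + \<delta>\<close>,
  which covers the vector handling in \<open>l\<close> rounds.\<close>

lemma solver_time_bigo:
  assumes T: "(\<lambda>n. real (T n)) \<in> O(\<lambda>n. real n powr (3 - \<epsilon>))"
    and m: "(\<lambda>n. real (m n)) \<in> \<Theta>(\<lambda>n. real n powr 2)" and l: "(\<lambda>n. real (l n)) \<in> \<Theta>(\<lambda>n. real n powr 1)"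
    and \<sigma>: "subpolynomial \<sigma>" and \<delta>: "0 < \<delta>" "6 * \<delta> \<le> \<epsilon>" "6 * \<delta> \<le> 1"
  shows "(\<lambda>n. real (solver_time T m l \<sigma> n)) \<in> O(\<lambda>n. (real (m n) * real (l n)) powr (1 - \<delta>))"
proof -
  let ?N = "omv_size l \<sigma>"
  \<comment> \<open>The exponent of \<open>n\<close> in \<open>(m l) powr (1 - \<delta>)\<close>,
    since \<open>m l\<close> grows like the cube of \<open>n\<close>.\<close>
  define b where "b = 3 - 3 * \<delta>"
  have N: "(\<lambda>n. real (?N n)) \<in> O(\<lambda>n. real n powr (1 + \<delta>))"
    using l by (intro omv_size_bigo[OF _ subpolynomial_bigo[OF \<sigma> \<delta>(1)] \<delta>(1)]) auto
  have *: "f \<in> O(\<lambda>n. real n powr b)" if "f \<in> O(\<lambda>n. real n powr a)" "a \<le> b" for f :: "nat \<Rightarrow> real" and a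
    using that powr_bigo_nat by (blast intro: landau_o.big_trans)
  have "(\<lambda>n. real (T n)) \<in> O(\<lambda>n. real n powr (3 - 6 * \<delta>))"
    using T powr_bigo_nat[of "3 - \<epsilon>" "3 - 6 * \<delta>"] \<delta> by (auto intro: landau_o.big_trans)
  then have "(\<lambda>n. real (T (?N n))) \<in> O(\<lambda>n. real (?N n) powr (3 - 6 * \<delta>))"
    using filterlim_omv_size by (rule landau_o.big.compose)
  also have "(\<lambda>n. real (?N n) powr (3 - 6 * \<delta>)) \<in> O(\<lambda>n. (real n powr (1 + \<delta>)) powr (3 - 6 * \<delta>))"
    using N by (rule bigo_powr_nonneg) (use \<delta> in auto)
  finally have "(\<lambda>n. real (T (?N n))) \<in> O(\<lambda>n. real n powr ((1 + \<delta>) * (3 - 6 * \<delta>)))"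
    by (simp add: powr_powr)
  then have time_T: "(\<lambda>n. real (T (?N n))) \<in> O(\<lambda>n. real n powr b)"
    by (rule *) (use \<delta> in \<open>auto simp: b_def algebra_simps\<close>)
  have time_m: "(\<lambda>n. real (m n)) \<in> O(\<lambda>n. real n powr b)"
    using m \<delta> by (intro *[of _ 2]) (auto simp: b_def)
  have time_1: "(\<lambda>n. 1) \<in> O(\<lambda>n. real n powr b)"
    using \<delta> by (intro one_bigo_powr) (auto simp: b_def)
  have time_n: "(\<lambda>n. real n) \<in> O(\<lambda>n. real n powr b)"
    using \<delta> by (intro *[of _ 1]) (auto simp: b_def)
  have l_le: "(\<lambda>n. real (l n)) \<in> O(\<lambda>n. real n powr 1)"
    using l by auto
  have time_l: "(\<lambda>n. real (l n)) \<in> O(\<lambda>n. real n powr b)"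
    using l_le \<delta> by (intro *[of _ 1]) (auto simp: b_def)
  have "(\<lambda>n. real (l n) * real (?N n)) \<in> O(\<lambda>n. real n powr 1 * real n powr (1 + \<delta>))"
    using l_le N by (rule landau_o.big.mult)
  then have time_lN: "(\<lambda>n. real (l n) * real (?N n)) \<in> O(\<lambda>n. real n powr b)"
    unfolding powr_add[symmetric] by (rule *) (use \<delta> in \<open>auto simp: b_def\<close>)
  have "(\<lambda>n. real (solver_time T m l \<sigma> n)) = (\<lambda>n. 2 * real (T (?N n)) + 15 * real (m n) +
      20 * (real (l n) * real (?N n)) + 21 * real (l n) + 10 * real n + 50 * 1)"
    by (simp add: solver_time_def algebra_simps)
  also have "\<dots> \<in> O(\<lambda>n. real n powr b)"
    by (intro sum_in_bigo landau_o.big.cmult_in_iff[THEN iffD2] time_T time_m time_lN time_l time_n time_1) auto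
  also have "(\<lambda>n. real n powr b) \<in> O(\<lambda>n. (real (m n) * real (l n)) powr (1 - \<delta>))"
  proof -
    have "(\<lambda>n. real (m n) * real (l n)) \<in> \<Theta>(\<lambda>n. real n powr 2 * real n powr 1)"
      using m l by (rule landau_theta.mult)
    then have "(\<lambda>n. \<bar>real (m n) * real (l n)\<bar> powr (1 - \<delta>)) \<in> \<Theta>(\<lambda>n. \<bar>real n powr 2 * real n powr 1\<bar> powr (1 - \<delta>))"
      by (rule bigtheta_powr)
    moreover have "\<bar>real n powr 2 * real n powr 1\<bar> powr (1 - \<delta>) = real n powr b" for n
    proof -
      have "\<bar>real n powr 2 * real n powr 1\<bar> = real n powr 3"
        unfolding powr_add[symmetric] by simp
      then show ?thesis
        by (simp only: powr_powr b_def right_diff_distrib mult_1_right)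
    qed
    ultimately show ?thesis
      by (simp add: bigtheta_sym[of "\<lambda>n. real n powr b"] bigthetaD1 abs_mult)
  qed
  finally show ?thesis .
qed

text \<open>The sum exceeds both requirements, the word size of the OMv algorithm and the address
  length, and is easier to estimate than their maximum.\<close>

definition driver_word_size :: "(nat \<Rightarrow> nat) \<Rightarrow> (nat \<Rightarrow> nat) \<Rightarrow> (nat \<Rightarrow> nat) \<Rightarrow> (nat \<Rightarrow> nat) \<Rightarrow> nat \<Rightarrow> nat" where
  "driver_word_size w m l \<sigma> n = w (omv_size l \<sigma> n) + nat \<lceil>log 2 (real (memory_bound m l \<sigma> n))\<rceil>"

lemma memory_bound_le: "memory_bound m l \<sigma> n \<le> 2 ^ driver_word_size w m l \<sigma> n"
proof -
  let ?k = "nat \<lceil>log 2 (real (memory_bound m l \<sigma> n))\<rceil>"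
  have "0 < memory_bound m l \<sigma> n"
    by (simp add: memory_bound_def)
  then have "real (memory_bound m l \<sigma> n) = 2 powr log 2 (real (memory_bound m l \<sigma> n))"
    by simp
  also have "\<dots> \<le> 2 powr real ?k"
    by (intro powr_mono) linarith+
  also have "\<dots> = real (2 ^ ?k)"
    by (simp add: powr_realpow)
  finally have "memory_bound m l \<sigma> n \<le> 2 ^ ?k"
    by linarith
  also have "\<dots> \<le> 2 ^ driver_word_size w m l \<sigma> n"
    by (simp add: driver_word_size_def)
  finally show ?thesis .
qed

lemma driver_word_size_bigo:
  assumes w: "(\<lambda>n. real (w n)) \<in> O(\<lambda>n. ln (real n))"
    and m: "(\<lambda>n. real (m n)) \<in> O(\<lambda>n. real n powr 2)" and l: "(\<lambda>n. real (l n)) \<in> O(\<lambda>n. real n powr 1)"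
    and \<sigma>: "subpolynomial \<sigma>"
  shows "(\<lambda>n. real (Suc (driver_word_size w m l \<sigma> n))) \<in> O(\<lambda>n. ln (real n))"
proof -
  let ?N = "omv_size l \<sigma>"
  \<comment> \<open>The case \<open>\<delta> = 1\<close> of the size bound is enough, because only
    the logarithm of a polynomial matters here.\<close>
  have N: "(\<lambda>n. real (?N n)) \<in> O(\<lambda>n. real n powr 2)"
    using omv_size_bigo[OF l subpolynomial_bigo[OF \<sigma>, of 1]] by simp
  have "(\<lambda>n. real (w (?N n))) \<in> O(\<lambda>n. ln (real (?N n)))"
    using w filterlim_omv_size by (rule landau_o.big.compose)
  also have "(\<lambda>n. ln (real (?N n))) \<in> O(\<lambda>n. ln (real n))"
  proof (rule ln_bigo_of_polynomial[OF N])
    fix n :: nat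
    assume "0 < n"
    then show "1 \<le> ?N n"
      using omv_size_ge[of n l \<sigma>] by linarith
  qed
  finally have word: "(\<lambda>n. real (w (?N n))) \<in> O(\<lambda>n. ln (real n))" .
  have *: "f \<in> O(\<lambda>n. real n powr 4)" if "f \<in> O(\<lambda>n. real n powr a)" "a \<le> 4" for f :: "nat \<Rightarrow> real" and a
    using that powr_bigo_nat by (blast intro: landau_o.big_trans)
  have "(\<lambda>n. real (?N n) * real (?N n)) \<in> O(\<lambda>n. real n powr 2 * real n powr 2)"
    using N N by (rule landau_o.big.mult)
  then have NN: "(\<lambda>n. real (?N n) * real (?N n)) \<in> O(\<lambda>n. real n powr 4)"
    by (simp add: powr_add[symmetric])
  have n: "(\<lambda>n. real n) \<in> O(\<lambda>n. real n powr 4)"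
    by (rule *[of _ 1]) auto
  have "(\<lambda>n. real (memory_bound m l \<sigma> n)) = (\<lambda>n. 7 * 1 + 2 * real n + 3 * real (m n) + real (l n) +
      real (?N n) * real (?N n) + 2 * real (?N n))"
    by (simp add: memory_bound_def)
  also have "\<dots> \<in> O(\<lambda>n. real n powr 4)"
    by (intro sum_in_bigo landau_o.big.cmult_in_iff[THEN iffD2] one_bigo_powr n NN *[OF N] *[OF m] *[OF l]) auto
  finally have "(\<lambda>n. ln (real (memory_bound m l \<sigma> n))) \<in> O(\<lambda>n. ln (real n))"
    by (rule ln_bigo_of_polynomial) (simp add: memory_bound_def)
  then have "(\<lambda>n. log 2 (real (memory_bound m l \<sigma> n))) \<in> O(\<lambda>n. ln (real n))"
    unfolding log_def by simp
  then have "(\<lambda>n. log 2 (real (memory_bound m l \<sigma> n)) + 1) \<in> O(\<lambda>n. ln (real n))"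
    using one_bigo_ln by (rule sum_in_bigo)
  then have "(\<lambda>n. real (nat \<lceil>log 2 (real (memory_bound m l \<sigma> n))\<rceil>)) \<in> O(\<lambda>n. ln (real n))"
  proof (rule landau_o.big_trans[rotated], intro bigoI[of _ 1] always_eventually allI)
    fix n
    have "1 \<le> memory_bound m l \<sigma> n"
      by (simp add: memory_bound_def)
    then have "0 \<le> log 2 (real (memory_bound m l \<sigma> n))"
      by (subst zero_le_log_cancel_iff) auto
    then show "norm (real (nat \<lceil>log 2 (real (memory_bound m l \<sigma> n))\<rceil>))
        \<le> 1 * norm (log 2 (real (memory_bound m l \<sigma> n)) + 1)"
      by simp
  qed
  then have "(\<lambda>n. real (w (?N n)) + real (nat \<lceil>log 2 (real (memory_bound m l \<sigma> n))\<rceil>) + 1) \<in> O(\<lambda>n. ln (real n))"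
    by (intro sum_in_bigo word one_bigo_ln)
  then show ?thesis
    by (simp add: driver_word_size_def add_ac)
qed

theorem theorem5p2:
  shows "NFA_Acceptance_hypothesis \<longrightarrow> OMv_hypothesis"
proof
  assume hyp: NFA_Acceptance_hypothesis
  show OMv_hypothesis
    unfolding OMv_hypothesis_def
  proof (intro allI impI notI)
    fix \<epsilon> :: real
    assume "0 < \<epsilon>" and "\<exists>P Q T w. (\<lambda>n. real (T n)) \<in> O(\<lambda>n. real n powr (3 - \<epsilon>)) \<and>
      (\<lambda>n. real (w n)) \<in> O(\<lambda>n. ln (real n)) \<and> solves_omv P Q T w"
    then obtain P Q T w where T: "(\<lambda>n. real (T n)) \<in> O(\<lambda>n. real n powr (3 - \<epsilon>))"
      and w: "(\<lambda>n. real (w n)) \<in> O(\<lambda>n. ln (real n))" and omv: "solves_omv P Q T w"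
      by blast
    \<comment> \<open>The largest value that meets both \<open>6 * \<delta> \<le> \<epsilon>\<close>
      and \<open>6 * \<delta> \<le> 1\<close>.\<close>
    define \<delta> where "\<delta> = min \<epsilon> 1 / 6"
    have \<delta>: "0 < \<delta>" "6 * \<delta> \<le> \<epsilon>" "6 * \<delta> \<le> 1"
      using \<open>0 < \<epsilon>\<close> by (auto simp: \<delta>_def)
    have "\<exists>T' w'. (\<lambda>n. real (T' n)) \<in> O(\<lambda>n. (real (m n) * real (l n)) powr (1 - \<delta>)) \<and>
        (\<lambda>n. real (w' n)) \<in> O(\<lambda>n. ln (real n)) \<and> decides_nfa_acceptance (nfa_solver P Q) m l \<sigma> T' w'"
      if m: "(\<lambda>n. real (m n)) \<in> \<Theta>(\<lambda>n. real n powr 2)"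
        and l: "(\<lambda>n. real (l n)) \<in> \<Theta>(\<lambda>n. real n powr 1)" and \<sigma>: "subpolynomial \<sigma>" for m l \<sigma>
    proof (intro exI conjI)
      show "(\<lambda>n. real (solver_time T m l \<sigma> n)) \<in> O(\<lambda>n. (real (m n) * real (l n)) powr (1 - \<delta>))"
        using T m l \<sigma> \<delta> by (rule solver_time_bigo)
      show "(\<lambda>n. real (Suc (driver_word_size w m l \<sigma> n))) \<in> O(\<lambda>n. ln (real n))"
        using w bigthetaD1[OF m] bigthetaD1[OF l] \<sigma> by (rule driver_word_size_bigo)
      show "decides_nfa_acceptance (nfa_solver P Q) m l \<sigma> (solver_time T m l \<sigma>)
          (\<lambda>n. Suc (driver_word_size w m l \<sigma> n))"
        using omv memory_bound_le by (rule decides_nfa_solver) (simp add: driver_word_size_def)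
    qed
    \<comment> \<open>The hypothesis is contradicted at \<open>\<alpha> = 2\<close> and
      \<open>\<beta> = 1\<close>, with the single program \<open>nfa_solver P Q\<close> for all
      \<open>m\<close>, \<open>l\<close> and \<open>\<sigma>\<close>.\<close>
    moreover have "(2 :: real) \<in> {1..2}" "(0 :: real) < 1"
      by auto
    ultimately show False
      using hyp \<delta>(1) unfolding NFA_Acceptance_hypothesis_def by blast
  qed
qed

end
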